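(* Every heptagraph $G$ is $3$-colorable, i.e. there is a map $c: V(G)\to\{1,2,3\}$ with $c(u)\neq c(v)$ whenever $uv\in E(G)$.
   Context: All graphs are finite and simple. A hole is an induced cycle of length at least $4$; a hole is odd if its length is odd. A heptagraph is a graph that has no cycles of length less than $7$ and has no holes of odd length at least $9$. *)

theory Defs
  imports "Graph_Theory.Graph_Theory"
begin

text \<open>
  A finite simple graph is a \<open>pair_graph\<close>: finitely many vertices, no loops, and a symmetric set of
  arcs, each edge being represented by its two orientations. The library's \<open>cycle\<close> is a nonempty
  closed walk, given as the list of its arcs, with no repeated vertex; in a symmetric digraph it
  includes the two-arc walk along an edge and back, hence the bound below. The length of a cycle is
  the length of its arc list.
\<close>

definition graph_cycle :: "'a pair_pre_digraph \<Rightarrow> ('a \<times> 'a) list \<Rightarrow> bool" where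
  "graph_cycle G p \<longleftrightarrow> pre_digraph.cycle (with_proj G) p \<and> 3 \<le> length p"

text \<open>Every vertex of a cycle is the tail of exactly one of its arcs.\<close>

definition induced_cycle :: "'a pair_pre_digraph \<Rightarrow> ('a \<times> 'a) list \<Rightarrow> bool" where
  "induced_cycle G p \<longleftrightarrow> graph_cycle G p \<and>
     arcs (with_proj G \<restriction> (fst ` set p)) = set p \<union> (set p)\<inverse>"

definition hole :: "'a pair_pre_digraph \<Rightarrow> ('a \<times> 'a) list \<Rightarrow> bool" where
  "hole G p \<longleftrightarrow> induced_cycle G p \<and> 4 \<le> length p"

definition heptagraph :: "'a pair_pre_digraph \<Rightarrow> bool" where
  "heptagraph G \<longleftrightarrow> pair_graph G \<and>
     (\<nexists>p. graph_cycle G p \<and> length p < 7) \<and>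
     (\<nexists>p. hole G p \<and> odd (length p) \<and> 9 \<le> length p)"

end

theory Submission
  imports Defs
begin

text \<open>
  A graph that is not 3-colourable and has as few vertices as possible has minimum degree at least
  three and no cut vertex. A path outside a 7-hole \<open>C\<close> that is attached to \<open>C\<close> exactly at its two ends,
  at vertices of distance two or three on \<open>C\<close>, forms an odd hole with one of the two arcs of \<open>C\<close>, so it
  has exactly four or three vertices; this rigidity drives the argument.

  No closed neighbourhood \<open>N[x]\<close> separates the graph. Otherwise let \<open>A\<close> be a smallest component arising
  in this way. Exchanging Kempe chains gives neighbours \<open>y\<close>, \<open>y'\<close> of \<open>x\<close> between which all induced
  paths through \<open>A\<close> have four inner vertices, while by minimality no closed neighbourhood of a vertex
  of \<open>A\<close> separates; following third neighbours of inner vertices produces a path through \<open>A\<close> of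
  another length.

  Given that no star separates, a third neighbour of a vertex of a configuration around a 7-hole is
  joined to the rest of the configuration either directly or by a detour between the two
  neighbours of that vertex. This excludes first jumps between vertices at distance three, then
  jumps between vertices at distance two. On a 7-hole without such jumps, detours around two distant
  vertices do not touch each other, and rerouting the 7-hole along both gives an odd hole of length at least 11.
  Finally, Kempe chains at any vertex produce a 7-hole.
\<close>

section \<open>Induced paths and Kempe chains\<close>

text \<open>All numbers come from one count: two induced paths with common ends, with p and q inner
  vertices of different parity and no contact between them, close an odd hole of length p + q + 2;
  this must be 7, so p + q = 5, and the girth removes the solutions that are too small. The obstacle
  is that minimum degree three supplies only an edge leaving a configuration at a vertex, not a way
  back that avoids the two neighbours of that vertex in the configuration. That no star at these two
  neighbours separates is what supplies the way back. Since this cannot be assumed globally while it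
  is being proved, the results on third neighbours ask for \<open>star_free\<close> at two named
  vertices only; in a smallest star component these lie in \<open>A\<close>. Distance three precedes
  distance two because a jump over distance two creates a second 7-hole, on which some of the links
  to be excluded span distance three.\<close>

locale sgraph =
  fixes V :: "'a set" and E :: "'a \<Rightarrow> 'a \<Rightarrow> bool"
  assumes fin: "finite V"
    and Esym: "E u v \<Longrightarrow> E v u"
    and Eirr: "\<not> E u u"
    and inV: "E u v \<Longrightarrow> u \<in> V \<and> v \<in> V"
begin

fun ipath :: "'a list \<Rightarrow> bool" where
  "ipath [] \<longleftrightarrow> True"
| "ipath [x] \<longleftrightarrow> True"
| "ipath (x # y # ys) \<longleftrightarrow> E x y \<and> x \<notin> set (y # ys) \<and> (\<forall>z\<in>set ys. \<not> E x z) \<and> ipath (y # ys)"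

lemma ipath_Cons:
  "ys \<noteq> [] \<Longrightarrow> ipath (x # ys) \<longleftrightarrow> x \<notin> set ys \<and> (\<forall>z\<in>set ys. E x z \<longleftrightarrow> z = hd ys) \<and> ipath ys"
proof (cases ys)
  case (Cons y zs)
  have "hd ys \<notin> set (tl ys)" if "ipath ys"
    using that Cons by (cases zs) auto
  then show ?thesis using Cons by auto
qed simp

lemma ipath_append:
  assumes "xs \<noteq> []" "ys \<noteq> []"
  shows "ipath (xs @ ys) \<longleftrightarrow> ipath xs \<and> ipath ys \<and>
    (\<forall>x\<in>set xs. \<forall>y\<in>set ys. x \<noteq> y \<and> (E x y \<longleftrightarrow> x = last xs \<and> y = hd ys))"
  using assms
proof (induction xs rule: list_nonempty_induct)
  case (single x)
  then show ?case by (auto simp: ipath_Cons)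
next
  case (cons x xs)
  have in_set: "last xs \<in> set xs" "hd xs \<in> set xs" using cons by auto
  define Q where "Q \<longleftrightarrow> ipath xs \<and> ipath ys \<and>
    (\<forall>x\<in>set xs. \<forall>y\<in>set ys. x \<noteq> y \<and> (E x y \<longleftrightarrow> x = last xs \<and> y = hd ys))"
  have IH: "ipath (xs @ ys) \<longleftrightarrow> Q" using cons unfolding Q_def by blast
  have "ipath ((x # xs) @ ys) \<longleftrightarrow>
      x \<notin> set (xs @ ys) \<and> (\<forall>z\<in>set (xs @ ys). E x z \<longleftrightarrow> z = hd xs) \<and> Q"
    using cons(1) ipath_Cons[of "xs @ ys" x] IH by simp
  also have "\<dots> \<longleftrightarrow> Q \<and> x \<notin> set xs \<and> (\<forall>z\<in>set xs. E x z \<longleftrightarrow> z = hd xs) \<and>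
      (\<forall>z\<in>set ys. x \<noteq> z \<and> \<not> E x z)"
  proof -
    have "z \<noteq> hd xs" if "z \<in> set ys" Q for z
      using that in_set unfolding Q_def by metis
    then show ?thesis by auto
  qed
  also have "\<dots> \<longleftrightarrow> ipath (x # xs) \<and> ipath ys \<and>
    (\<forall>u\<in>set (x # xs). \<forall>y\<in>set ys. u \<noteq> y \<and> (E u y \<longleftrightarrow> u = last (x # xs) \<and> y = hd ys))"
  proof -
    have "x \<noteq> last xs" if "x \<notin> set xs" using that in_set by auto
    then show ?thesis using cons(1) unfolding Q_def by (auto simp: ipath_Cons)
  qed
  finally show ?case .
qed

lemma ipath_appendI:
  assumes "ipath xs" "ipath ys" "xs \<noteq> []" "ys \<noteq> []"
    "\<And>u v. u \<in> set xs \<Longrightarrow> v \<in> set ys \<Longrightarrow> u \<noteq> v \<and> (E u v \<longleftrightarrow> u = last xs \<and> v = hd ys)"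
  shows "ipath (xs @ ys)"
  using assms by (simp add: ipath_append)

lemma ipath_rev: "ipath (rev xs) \<longleftrightarrow> ipath xs"
proof (induction xs)
  case (Cons x xs)
  show ?case
  proof (cases "xs = []")
    case False
    then have *: "last (rev xs) = hd xs" "set (rev xs) = set xs" by (auto simp: last_rev)
    have "(\<forall>z\<in>set xs. z \<noteq> x \<and> (E z x \<longleftrightarrow> z = hd xs)) \<longleftrightarrow> x \<notin> set xs \<and> (\<forall>z\<in>set xs. E x z \<longleftrightarrow> z = hd xs)"
      using Esym by metis
    then show ?thesis using Cons False *
      by (simp add: ipath_append[of "rev xs" "[x]"] ipath_Cons last_rev) blast
  qed simp
qed simp

lemma ipath_appendD1: "ipath (xs @ ys) \<Longrightarrow> ipath xs"
  by (cases "xs = []"; cases "ys = []") (auto simp: ipath_append)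

lemma ipath_appendD2: "ipath (xs @ ys) \<Longrightarrow> ipath ys"
  by (cases "xs = []"; cases "ys = []") (auto simp: ipath_append)

lemma ipath_distinct: "ipath xs \<Longrightarrow> distinct xs"
  by (induction xs rule: ipath.induct) auto

lemma ipath_successively: "ipath xs \<Longrightarrow> successively E xs"
  by (induction xs rule: ipath.induct) auto

text \<open>Induction along the walk: prepend \<open>x\<close> to the induced path of the tail, cut
  at \<open>x\<close> itself if it occurs there, otherwise at its last neighbour, so that no chord
  from \<open>x\<close> remains.\<close>

lemma ipath_of_walk:
  assumes "successively E p" "p \<noteq> []"
  shows "\<exists>q. ipath q \<and> q \<noteq> [] \<and> set q \<subseteq> set p \<and> hd q = hd p \<and> last q = last p"
  using assms
proof (induction p)
  case (Cons x p)
  show ?case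
  proof (cases "p = []")
    case True
    then show ?thesis by (intro exI[of _ "[x]"]) auto
  next
    case False
    then have "successively E p" "E x (hd p)" using Cons.prems by (auto simp: successively_Cons)
    then obtain q where q: "ipath q" "q \<noteq> []" "set q \<subseteq> set p" "hd q = hd p" "last q = last p"
      using Cons.IH False by blast
    show ?thesis
    proof (cases "x \<in> set q")
      case True
      then obtain us vs where "q = us @ x # vs" by (meson split_list)
      then show ?thesis using q False ipath_appendD2[of us "x # vs"]
        by (intro exI[of _ "x # vs"]) auto
    next
      case xq: False
      have "\<exists>y\<in>set q. E x y" using q \<open>E x (hd p)\<close> by (metis hd_in_set)
      from split_list_last_prop[OF this]
      obtain us y vs where y: "q = us @ y # vs" "E x y" "\<forall>z\<in>set vs. \<not> E x z"
        by blast
      have "ipath (y # vs)" using y q(1) ipath_appendD2 by blast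
      then have "ipath (x # y # vs)" using y xq by auto
      then show ?thesis using q False y
        by (intro exI[of _ "x # y # vs"]) auto
    qed
  qed
qed simp

section \<open>Reachability, shortest paths and components inside a vertex set\<close>

definition reach :: "'a set \<Rightarrow> 'a \<Rightarrow> 'a \<Rightarrow> bool" where
  "reach S x y \<longleftrightarrow> (\<lambda>a b. E a b \<and> a \<in> S \<and> b \<in> S)\<^sup>*\<^sup>* x y"

text \<open>This also holds for \<open>x\<close> outside \<open>S\<close>, which is why later lemmas
  ask for \<open>x \<in> S\<close> separately.\<close>

lemma reach_refl: "reach S x x"
  by (simp add: reach_def)

lemma reach_trans: "reach S x y \<Longrightarrow> reach S y z \<Longrightarrow> reach S x z"
  unfolding reach_def by (rule rtranclp_trans)

lemma reach_step: "reach S x y \<Longrightarrow> E y z \<Longrightarrow> y \<in> S \<Longrightarrow> z \<in> S \<Longrightarrow> reach S x z"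
  unfolding reach_def by (rule rtranclp.rtrancl_into_rtrancl) auto

lemma reach_sym: "reach S x y \<Longrightarrow> reach S y x"
  unfolding reach_def
proof (induction rule: rtranclp_induct)
  case (step y z)
  then have "E z y" by (blast intro: Esym)
  then show ?case using step by (intro converse_rtranclp_into_rtranclp[of _ z y]) auto
qed simp

lemma reach_mono: "reach S x y \<Longrightarrow> S \<subseteq> T \<Longrightarrow> reach T x y"
  unfolding reach_def by (erule rtranclp_mono[THEN predicate2D, rotated]) auto

lemma reach_in: "reach S x y \<Longrightarrow> x \<in> S \<Longrightarrow> y \<in> S"
  unfolding reach_def by (erule rtranclp.cases) auto

lemma reach_closed:
  assumes "reach S x y" "x \<in> B" "\<And>u v. u \<in> B \<Longrightarrow> E u v \<Longrightarrow> v \<in> S \<Longrightarrow> v \<in> B"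
  shows "y \<in> B"
  using assms(1,2) unfolding reach_def
  by (induction rule: rtranclp_induct) (auto intro: assms(3))

lemma reach_walk:
  assumes "reach S x y" "x \<in> S"
  shows "\<exists>p. successively E p \<and> p \<noteq> [] \<and> set p \<subseteq> S \<and> hd p = x \<and> last p = y"
  using assms unfolding reach_def
proof (induction rule: rtranclp_induct)
  case base
  then show ?case by (intro exI[of _ "[x]"]) auto
next
  case (step y z)
  then obtain p where "successively E p \<and> p \<noteq> [] \<and> set p \<subseteq> S \<and> hd p = x \<and> last p = y" by blast
  then show ?case using step
    by (intro exI[of _ "p @ [z]"]) (auto simp: successively_append_iff)
qed

text \<open>A shortest induced path among those from \<open>X\<close> to \<open>Y\<close> can be
  shortened at any further vertex of \<open>X\<close> or \<open>Y\<close>, so it meets these sets at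
  its ends only. Taking \<open>X\<close> and \<open>Y\<close> to be neighbourhoods of two vertices
  makes the path extend to an induced path between them.\<close>

lemma shortest_path:
  assumes "reach S x y" "x \<in> S" "x \<in> X" "y \<in> Y"
  obtains p where "ipath p" "p \<noteq> []" "set p \<subseteq> S" "hd p \<in> X" "last p \<in> Y"
    "\<And>z. z \<in> set p \<Longrightarrow> z \<in> X \<Longrightarrow> z = hd p" "\<And>z. z \<in> set p \<Longrightarrow> z \<in> Y \<Longrightarrow> z = last p"
proof -
  let ?P = "\<lambda>p. ipath p \<and> p \<noteq> [] \<and> set p \<subseteq> S \<and> hd p \<in> X \<and> last p \<in> Y"
  obtain p0 where p0: "successively E p0" "p0 \<noteq> []" "set p0 \<subseteq> S" "hd p0 = x" "last p0 = y"
    using reach_walk[OF assms(1,2)] by blast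
  then have "\<exists>q. ?P q" using ipath_of_walk[OF p0(1,2)] assms by (metis subset_trans)
  then obtain p where p: "?P p" "\<And>q. ?P q \<Longrightarrow> length p \<le> length q"
    using ex_has_least_nat[of ?P _ length] by blast
  have "z = hd p" if z: "z \<in> set p" "z \<in> X" for z
  proof -
    obtain us vs where uv: "p = us @ z # vs" using z split_list by metis
    then have "ipath (z # vs)" using p ipath_appendD2 by blast
    then have "length p \<le> length (z # vs)" using p uv z by (intro p(2)) auto
    then show ?thesis using uv by auto
  qed
  moreover have "z = last p" if z: "z \<in> set p" "z \<in> Y" for z
  proof -
    obtain us vs where uv: "p = (us @ [z]) @ vs" using z split_list by (metis append.assoc append_Cons append_Nil)
    then have "ipath (us @ [z])" using p ipath_appendD1 by blast
    moreover have "hd (us @ [z]) = hd p" using uv by (cases us) auto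
    ultimately have "length p \<le> length (us @ [z])" using p(1) uv z by (intro p(2)) auto
    then show ?thesis using uv by auto
  qed
  ultimately show ?thesis using that p(1) by blast
qed

definition conn :: "'a set \<Rightarrow> bool" where
  "conn K \<longleftrightarrow> K \<noteq> {} \<and> (\<forall>x\<in>K. \<forall>y\<in>K. reach K x y)"

definition comp :: "'a set \<Rightarrow> 'a \<Rightarrow> 'a set" where
  "comp S x = {y. reach S x y}"

lemma comp_self: "x \<in> comp S x"
  by (simp add: comp_def reach_refl)

lemma comp_subset: "x \<in> S \<Longrightarrow> comp S x \<subseteq> S"
  by (auto simp: comp_def reach_in)

lemma comp_closed: "y \<in> comp S x \<Longrightarrow> x \<in> S \<Longrightarrow> E y z \<Longrightarrow> z \<in> S \<Longrightarrow> z \<in> comp S x"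
  using comp_subset by (auto simp: comp_def intro: reach_step)

lemma reach_comp:
  assumes "x \<in> S" "reach S x y" shows "reach (comp S x) x y"
  using assms(2) unfolding reach_def
proof (induction rule: rtranclp_induct)
  case (step y z)
  then have "y \<in> comp S x" "z \<in> comp S x"
    unfolding comp_def reach_def by (auto intro: rtranclp.rtrancl_into_rtrancl)
  then show ?case using step by (auto intro: rtranclp.rtrancl_into_rtrancl)
qed simp

lemma comp_conn: "x \<in> S \<Longrightarrow> conn (comp S x)"
  unfolding conn_def using comp_self reach_comp reach_sym reach_trans
  by (metis comp_def empty_iff mem_Collect_eq)

lemma conn_ipath: "ipath p \<Longrightarrow> p \<noteq> [] \<Longrightarrow> conn (set p)"
proof (induction p)
  case (Cons x p)
  show ?case
  proof (cases "p = []")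
    case True
    then show ?thesis by (auto simp: conn_def reach_refl)
  next
    case False
    then have p: "conn (set p)" "E x (hd p)" "hd p \<in> set p"
      using Cons ipath_appendD2[of "[x]" p] by (auto simp: ipath_Cons)
    have 1: "reach (set (x # p)) x y" if "y \<in> set p" for y
    proof -
      have "reach (set p) (hd p) y" using p that by (auto simp: conn_def)
      then have "reach (set (x # p)) (hd p) y" by (rule reach_mono) auto
      moreover have "reach (set (x # p)) x (hd p)"
        using p by (intro reach_step[OF reach_refl]) auto
      ultimately show ?thesis using reach_trans by blast
    qed
    have 2: "reach (set (x # p)) y z" if "y \<in> set p" "z \<in> set p" for y z
      by (rule reach_trans[OF reach_sym[OF 1[OF that(1)]] 1[OF that(2)]])
    show ?thesis using 1 2 reach_sym[OF 1] reach_refl[of "set (x # p)" x] by (auto simp: conn_def)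
  qed
qed simp

section \<open>Colourings with three colours and Kempe exchanges\<close>

definition col :: "'a set \<Rightarrow> ('a \<Rightarrow> nat) \<Rightarrow> bool" where
  "col W c \<longleftrightarrow> (\<forall>u\<in>W. c u \<in> {1,2,3}) \<and> (\<forall>u\<in>W. \<forall>v\<in>W. E u v \<longrightarrow> c u \<noteq> c v)"

lemma alternate:
  assumes "successively E p" "p \<noteq> []" "set p \<subseteq> W" "col W c" "\<forall>u\<in>set p. c u = a \<or> c u = b"
  shows "c (hd p) = c (last p) \<longleftrightarrow> odd (length p)"
  using assms
proof (induction p rule: induct_list012)
  case (3 x y zs)
  then have *: "(c y = c (last (y # zs))) = odd (length (y # zs))" by auto
  have "c x \<noteq> c y" using 3 by (auto simp: col_def)
  moreover have "last (y # zs) \<in> set (y # zs)" by (rule last_in_set) simp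
  then have "c (last (y # zs)) = a \<or> c (last (y # zs)) = b" using 3(7) by auto
  moreover have "c x = a \<or> c x = b" "c y = a \<or> c y = b" using 3(7) by auto
  ultimately show ?case using * by auto
qed auto

text \<open>Exchange \<open>a\<close> and \<open>b\<close> on every Kempe component that contains a
  vertex of \<open>Y\<close> coloured \<open>b\<close>. This fails only if such a component also has
  a vertex of \<open>Y\<close> coloured \<open>a\<close>; a shortest path between the two kinds
  alternates colours between differently coloured ends, so its number of inner vertices is
  even.\<close>

lemma kempe:
  assumes c: "col W c" and "Y \<subseteq> W" and ab: "a \<noteq> b" "a \<in> {1,2,3}" "b \<in> {1,2,3}"
    and no: "\<And>y y' L. \<lbrakk>y \<in> Y; y' \<in> Y; ipath (y # L @ [y']); set L \<subseteq> W - Y; even (length L);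
              \<forall>u\<in>set L. c u = a \<or> c u = b\<rbrakk> \<Longrightarrow> False"
  shows "\<exists>c'. col W c' \<and> (\<forall>y\<in>Y. c' y \<noteq> b) \<and> (\<forall>w\<in>W. c w \<noteq> a \<and> c w \<noteq> b \<longrightarrow> c' w = c w)"
proof -
  define S where "S = {w\<in>W. c w = a \<or> c w = b}"
  define M where "M = {w\<in>S. \<exists>y\<in>Y. c y = b \<and> reach S y w}"
  define c' where "c' w = (if w \<in> M then (if c w = a then b else a) else c w)" for w
  have M: "v \<in> M" if "u \<in> M" "E u v" "v \<in> S" for u v
    using that reach_step[of S _ u v] unfolding M_def by blast
  have "c' u \<noteq> c' v" if "u \<in> W" "v \<in> W" "E u v" for u v
  proof -
    have ne: "c u \<noteq> c v" using that c by (auto simp: col_def)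
    show ?thesis
    proof (cases "u \<in> S \<and> v \<in> S")
      case True
      then have "u \<in> M \<longleftrightarrow> v \<in> M" using M that Esym by blast
      then show ?thesis using True ne by (auto simp: c'_def S_def)
    next
      case False
      then show ?thesis using that ne ab unfolding c'_def M_def S_def by auto
    qed
  qed
  moreover have "c' u \<in> {1,2,3}" if "u \<in> W" for u
    using that c ab by (auto simp: c'_def col_def)
  moreover have "c' y \<noteq> b" if y: "y \<in> Y" for y
  proof
    assume eq: "c' y = b"
    have "y \<notin> M \<Longrightarrow> c y = b \<Longrightarrow> False" using y \<open>Y \<subseteq> W\<close> reach_refl[of S y]
      by (auto simp: M_def S_def)
    then have yM: "y \<in> M" "c y = a" using eq ab by (auto simp: c'_def split: if_splits)
    then obtain y0 where y0: "y0 \<in> Y" "c y0 = b" "reach S y0 y" by (auto simp: M_def)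
    \<comment> \<open>All vertices of the path are coloured \<open>a\<close> or \<open>b\<close>, so
      one in \<open>Y\<close> lies in \<open>?X\<close> or \<open>?Z\<close> and is therefore an
      end: the inner vertices avoid \<open>Y\<close>.\<close>
    let ?X = "{u\<in>Y. c u = b}" and ?Z = "{u\<in>Y. c u = a}"
    obtain p where p: "ipath p" "p \<noteq> []" "set p \<subseteq> S" "hd p \<in> ?X" "last p \<in> ?Z"
      "\<And>z. z \<in> set p \<Longrightarrow> z \<in> ?X \<Longrightarrow> z = hd p" "\<And>z. z \<in> set p \<Longrightarrow> z \<in> ?Z \<Longrightarrow> z = last p"
      using shortest_path[of S y0 y ?X ?Z] y0 y yM \<open>Y \<subseteq> W\<close> by (auto simp: S_def)
    have "c (hd p) \<noteq> c (last p)" using p ab by auto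
    then have len: "even (length p)" and ne: "hd p \<noteq> last p"
      using alternate[OF ipath_successively[OF p(1)] p(2) _ c, of a b] p(3) by (auto simp: S_def)
    then have "tl p \<noteq> []" using p(2) by (cases p) auto
    then obtain L where L: "p = hd p # L @ [last p]"
      using p(2) by (metis append_butlast_last_id last_tl list.collapse)
    have d: "distinct p" using p ipath_distinct by blast
    have "distinct (hd p # L @ [last p])" using d L by simp
    then have hL: "hd p \<notin> set L" "last p \<notin> set L" by auto
    have LS: "set L \<subseteq> S" using p(3) L by (metis Un_subset_iff set_append set_subset_Cons subset_trans)
    have Lp: "z \<in> set p" if "z \<in> set L" for z using L that
      by (metis Un_iff list.set_intros(2) set_append)
    have "z \<notin> Y" if "z \<in> set L" for z
      using p(6)[of z] p(7)[of z] Lp[OF that] LS that hL by (auto simp: S_def)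
    moreover have "even (length L)" using len L by (metis even_Suc length_Cons length_append_singleton)
    moreover have "ipath (hd p # L @ [last p])" using p(1) L by simp
    ultimately show False using no[of "hd p" "last p" L] p(4,5) LS by (auto simp: S_def)
  qed
  moreover have "\<forall>w\<in>W. c w \<noteq> a \<and> c w \<noteq> b \<longrightarrow> c' w = c w"
    by (auto simp: c'_def M_def S_def)
  ultimately show ?thesis unfolding col_def by blast
qed

text \<open>\<open>A\<close> is a component, but not the only one, of the graph without the closed neighbourhood of \<open>x\<close>.\<close>

definition star_sep :: "'a \<Rightarrow> 'a set \<Rightarrow> bool" where
  "star_sep x A \<longleftrightarrow> conn A \<and> A \<subseteq> V \<and> x \<notin> A \<and> (\<forall>a\<in>A. \<not> E x a) \<and> (\<forall>a\<in>A. \<forall>b. E a b \<longrightarrow> b \<in> A \<or> E x b) \<and>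
     (\<exists>t\<in>V. t \<notin> A \<and> t \<noteq> x \<and> \<not> E x t)"

definition star_free :: "'a \<Rightarrow> bool" where
  "star_free w \<longleftrightarrow> (\<forall>A. \<not> star_sep w A)"

definition swp :: "nat \<Rightarrow> nat \<Rightarrow> nat \<Rightarrow> nat" where
  "swp a b n = (if n = a then b else if n = b then a else n)"

lemma col_swp: "col W c \<Longrightarrow> a \<in> {1,2,3} \<Longrightarrow> b \<in> {1,2,3} \<Longrightarrow> col W (\<lambda>u. swp a b (c u))"
proof -
  assume a: "col W c" "a \<in> {1,2,3}" "b \<in> {1,2,3}"
  have "swp a b m = swp a b n \<longleftrightarrow> m = n" for m n by (auto simp: swp_def)
  moreover have "swp a b n \<in> {1,2,3}" if "n \<in> {1,2,3}" for n using a(2,3) that unfolding swp_def by presburger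
  ultimately show ?thesis using a(1) unfolding col_def by blast
qed

end

section \<open>Seven-holes and their jumps\<close>

text \<open>An odd hole is presented as an induced path \<open>q\<close> with an even number of
  vertices and a vertex \<open>a\<close> adjacent on it exactly to its ends. Its length is
  \<open>length q + 1\<close>, so 6 stands for a 7-hole; this value combines the girth with the
  absence of longer odd holes.\<close>

locale hepta = sgraph +
  assumes girth: "\<lbrakk>successively E p; distinct p; E (last p) (hd p); 3 \<le> length p\<rbrakk> \<Longrightarrow> 7 \<le> length p"
    and odd_hole: "\<lbrakk>ipath q; a \<notin> set q; \<forall>z\<in>set q. E a z \<longleftrightarrow> z = hd q \<or> z = last q;
      even (length q); 4 \<le> length q\<rbrakk> \<Longrightarrow> length q = 6"
begin

section \<open>Short cycles and gluing two paths\<close>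

lemma neqE: "E a b \<Longrightarrow> a \<noteq> b"
  using Eirr by blast

lemma no3: "\<lbrakk>E a b; E b c; E c a\<rbrakk> \<Longrightarrow> False"
  using girth[of "[a,b,c]"] neqE by auto

lemma no4: "\<lbrakk>E a b; E b c; E c d; E d a; a \<noteq> c; b \<noteq> d\<rbrakk> \<Longrightarrow> False"
  using girth[of "[a,b,c,d]"] neqE by auto

text \<open>A coincidence of two vertices would leave a triangle, so no distinctness is assumed. For
  six vertices a coincidence at distance three again leaves a triangle, but one at distance two must
  be excluded by hypothesis.\<close>

lemma no5: "\<lbrakk>E a b; E b c; E c d; E d e; E e a\<rbrakk> \<Longrightarrow> False"
  using girth[of "[a,b,c,d,e]"] no3[of c d e] no3[of a b c] no3[of a b e] no3[of b c d]
    neqE[of a b] neqE[of b c] neqE[of c d] neqE[of d e] neqE[of e a] by auto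

lemma no6: "\<lbrakk>E a b; E b c; E c d; E d e; E e f; E f a; a \<noteq> c; b \<noteq> d; c \<noteq> e; d \<noteq> f; e \<noteq> a; f \<noteq> b\<rbrakk> \<Longrightarrow> False"
  using girth[of "[a,b,c,d,e,f]"] no3[of a b c] no3[of b c d] no3[of c d e]
    neqE[of a b] neqE[of b c] neqE[of c d] neqE[of d e] neqE[of e f] neqE[of f a] by auto

text \<open>\<open>P\<close>, \<open>b\<close> and the reversal of \<open>Q\<close> form an induced
  path on which \<open>a\<close> sees exactly the two ends. The resulting hole has length
  \<open>length P + length Q + 2\<close>, which is odd and hence 7.\<close>

lemma glue:
  assumes "ipath (a # P @ [b])" "ipath (a # Q @ [b])" "P \<noteq> []" "Q \<noteq> []"
    and "set P \<inter> set Q = {}" and ne: "\<And>x y. x \<in> set P \<Longrightarrow> y \<in> set Q \<Longrightarrow> \<not> E x y"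
    and "odd (length P + length Q)"
  shows "length P + length Q = 5"
proof -
  let ?q = "P @ b # rev Q"
  have P0: "ipath (P @ [b])" "a \<notin> set (P @ [b])" "\<forall>z\<in>set (P @ [b]). E a z \<longleftrightarrow> z = hd P"
    using assms(1,3) ipath_Cons[of "P @ [b]" a] by simp_all
  then have "b \<noteq> hd P" using ipath_distinct[OF P0(1)] assms(3) by auto
  then have P: "ipath (P @ [b])" "a \<notin> set P" "a \<noteq> b" "\<not> E a b" "\<forall>z\<in>set P. E a z \<longleftrightarrow> z = hd P"
    using P0 by auto
  have Q: "ipath (Q @ [b])" "a \<notin> set Q" "\<forall>z\<in>set Q. E a z \<longleftrightarrow> z = hd Q"
    using assms(2,4) ipath_Cons[of "Q @ [b]" a] by simp_all
  have Q': "ipath (b # rev Q)" using Q(1) ipath_rev[of "Q @ [b]"] by simp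
  have P2: "ipath P" "\<forall>x\<in>set P. x \<noteq> b \<and> (E x b \<longleftrightarrow> x = last P)"
    using P(1) assms(3) by (auto simp: ipath_append)
  have "ipath ?q"
    using P2 Q' assms(3,4,5) ne by (subst ipath_append) auto
  moreover have "a \<notin> set ?q" using P Q by auto
  moreover have "hd ?q = hd P" "last ?q = hd Q" using assms(3,4) by (auto simp: last_rev)
  moreover have "hd P \<in> set P" "hd Q \<in> set Q" using assms(3,4) by auto
  then have "\<forall>z\<in>set ?q. E a z \<longleftrightarrow> z = hd P \<or> z = hd Q"
    using P Q ne assms(5) by auto
  moreover have "length P + length Q \<noteq> 1" using assms(3,4) by (cases P; cases Q) auto
  then have "4 \<le> length ?q" using assms(7) by simp presburger
  ultimately have "length ?q = 6" using assms(7) by (intro odd_hole) auto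
  then show ?thesis by simp
qed

text \<open>Together with \<open>x\<close> the path closes a cycle of length
  \<open>length P + 3\<close>.\<close>

lemma path_girth:
  assumes "ipath (a # P @ [b])" "E x a" "E x b" "x \<notin> set (a # P @ [b])"
  shows "4 \<le> length P"
proof -
  have "successively E (a # P @ [b])" "distinct (a # P @ [b])"
    using assms(1) ipath_successively ipath_distinct by blast+
  then have "7 \<le> length (x # a # P @ [b])"
    using assms Esym by (intro girth) auto
  then show ?thesis by simp
qed

section \<open>Seven-cycles and the vertices next to them\<close>

definition hole7 where
  "hole7 a b c d e f g \<longleftrightarrow> distinct [a,b,c,d,e,f,g] \<and> E a b \<and> E b c \<and> E c d \<and> E d e \<and> E e f \<and> E f g \<and> E g a"

lemma hole7_rev: "hole7 a b c d e f g \<Longrightarrow> hole7 g f e d c b a"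
  unfolding hole7_def by (simp, blast intro: Esym)

lemma hole7_rots:
  assumes "hole7 a b c d e f g"
  shows "hole7 b c d e f g a" "hole7 c d e f g a b" "hole7 d e f g a b c" "hole7 e f g a b c d"
    "hole7 f g a b c d e" "hole7 g a b c d e f"
  using assms unfolding hole7_def by auto

lemma hole7_edges: "hole7 a b c d e f g \<Longrightarrow> E a b \<and> E b c \<and> E c d \<and> E d e \<and> E e f \<and> E f g \<and> E g a \<and>
    E b a \<and> E c b \<and> E d c \<and> E e d \<and> E f e \<and> E g f \<and> E a g"
  unfolding hole7_def by (blast intro: Esym)

text \<open>A chord would cut off a cycle of length at most 4. This is why \<open>hole7\<close> asks
  only for a 7-cycle.\<close>

lemma hole7_chord1: assumes "hole7 a b c d e f g" shows "\<not> E a c \<and> \<not> E a d \<and> \<not> E a e \<and> \<not> E a f"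
proof -
  note h = assms[unfolded hole7_def distinct.simps list.set insert_iff empty_iff de_Morgan_disj simp_thms]
  show ?thesis using h no3[of a b c] no4[of a b c d] no4[of a e f g] no3[of a f g] Esym by blast
qed

lemma hole7_chords:
  assumes "hole7 a b c d e f g"
  shows "\<not> E a c" "\<not> E a d" "\<not> E a e" "\<not> E a f" "\<not> E b d" "\<not> E b e" "\<not> E b f" "\<not> E b g"
    "\<not> E c e" "\<not> E c f" "\<not> E c g" "\<not> E c a" "\<not> E d f" "\<not> E d g" "\<not> E d a" "\<not> E d b"
    "\<not> E e g" "\<not> E e a" "\<not> E e b" "\<not> E e c" "\<not> E f a" "\<not> E f b" "\<not> E f c" "\<not> E f d"
    "\<not> E g b" "\<not> E g c" "\<not> E g d" "\<not> E g e"
  using hole7_chord1[OF assms] hole7_rots[OF assms, THEN hole7_chord1] by simp_all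

text \<open>Two vertices of a 7-cycle are at distance at most 3, so a second neighbour would close a
  cycle of length at most 5.\<close>

lemma hole7_nbr1:
  assumes "hole7 a b c d e f g" "x \<notin> {a,b,c,d,e,f,g}" "E x a" "E x z" "z \<in> {a,b,c,d,e,f,g}"
  shows "z = a"
proof -
  note h = assms(1)[unfolded hole7_def distinct.simps list.set insert_iff empty_iff de_Morgan_disj simp_thms]
  have x: "x \<noteq> b" "x \<noteq> c" "x \<noteq> f" "x \<noteq> g" using assms by auto
  have "\<not> E x b" using h assms(3) no3 Esym by blast
  moreover have "\<not> E x g" using h assms(3) no3 Esym by blast
  moreover have "\<not> E x c" using h x assms(3) no4[of x a b c] Esym by blast
  moreover have "\<not> E x f" using h x assms(3) no4[of x a g f] Esym by blast
  moreover have "\<not> E x d" using h assms(3) no5[of x a b c d] Esym by blast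
  moreover have "\<not> E x e" using h assms(3) no5[of x a g f e] Esym by blast
  ultimately show ?thesis using assms(4,5) by auto
qed

lemma hole7_nbr:
  assumes "hole7 a b c d e f g" "x \<notin> {a,b,c,d,e,f,g}" "E x y" "E x z"
    "y \<in> {a,b,c,d,e,f,g}" "z \<in> {a,b,c,d,e,f,g}"
  shows "z = y"
  using assms(5) hole7_nbr1[OF assms(1), of x z] hole7_nbr1[OF hole7_rots(1)[OF assms(1)], of x z]
    hole7_nbr1[OF hole7_rots(2)[OF assms(1)], of x z] hole7_nbr1[OF hole7_rots(3)[OF assms(1)], of x z]
    hole7_nbr1[OF hole7_rots(4)[OF assms(1)], of x z] hole7_nbr1[OF hole7_rots(5)[OF assms(1)], of x z]
    hole7_nbr1[OF hole7_rots(6)[OF assms(1)], of x z] assms(2,3,4,6)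
  by (simp only: insert_iff empty_iff simp_thms de_Morgan_disj) (elim disjE; simp)

text \<open>An edge \<open>x x'\<close> and the shorter arc between the two attachments would form a
  cycle of length at most 6.\<close>

lemma hole7_nbrs1:
  assumes "hole7 a b c d e f g" "x \<notin> {a,b,c,d,e,f,g}" "x' \<notin> {a,b,c,d,e,f,g}" "E x a" "E x' z"
    "z \<in> {a,b,c,d,e,f,g}"
  shows "\<not> E x x'"
proof
  assume xx: "E x x'"
  note h = assms(1)[unfolded hole7_def distinct.simps list.set insert_iff empty_iff de_Morgan_disj simp_thms]
  have x: "x \<noteq> b" "x \<noteq> c" "x \<noteq> f" "x \<noteq> g" "x' \<noteq> a" "x' \<noteq> b" "x' \<noteq> c" "x' \<noteq> g" "x' \<noteq> f" "x \<noteq> a" "x' \<noteq> d" "x' \<noteq> e" "x \<noteq> d" "x \<noteq> e"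
    using assms by auto
  have e: "E x' x" "E a x" using assms xx Esym by blast+
  note ed = hole7_edges[OF assms(1)]
  have "\<not> E x' a" using assms(4) xx e no3[of x a x'] Esym by blast
  moreover have "\<not> E x' b" using h x e assms(4) no4[of x a b x'] Esym[of x' b] by auto
  moreover have "\<not> E x' g" using h x e ed assms(4) no4[of x a g x'] Esym[of x' g] by auto
  moreover have "\<not> E x' c" using h e assms(4) no5[of x a b c x'] Esym[of x' c] by auto
  moreover have "\<not> E x' f" using h e ed assms(4) no5[of x a g f x'] Esym[of x' f] by auto
  moreover have "\<not> E x' d" using h x e assms(4) no6[of x a b c d x'] Esym[of x' d] by auto
  moreover have "\<not> E x' e" using h x e ed assms(4) no6[of x a g f e x'] Esym[of x' e] by auto
  ultimately show False using assms(5,6) by auto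
qed

lemma hole7_nbrs:
  assumes "hole7 a b c d e f g" "x \<notin> {a,b,c,d,e,f,g}" "x' \<notin> {a,b,c,d,e,f,g}" "E x y" "E x' z"
    "y \<in> {a,b,c,d,e,f,g}" "z \<in> {a,b,c,d,e,f,g}"
  shows "\<not> E x x'"
  using assms(6) hole7_nbrs1[OF assms(1), of x x' z] hole7_nbrs1[OF hole7_rots(1)[OF assms(1)], of x x' z]
    hole7_nbrs1[OF hole7_rots(2)[OF assms(1)], of x x' z] hole7_nbrs1[OF hole7_rots(3)[OF assms(1)], of x x' z]
    hole7_nbrs1[OF hole7_rots(4)[OF assms(1)], of x x' z] hole7_nbrs1[OF hole7_rots(5)[OF assms(1)], of x x' z]
    hole7_nbrs1[OF hole7_rots(6)[OF assms(1)], of x x' z] assms(2,3,4,5,7)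
  by (simp only: insert_iff empty_iff simp_thms de_Morgan_disj) (elim disjE; simp)

section \<open>Jumps over a 7-hole\<close>

definition jump :: "'a set \<Rightarrow> 'a list \<Rightarrow> 'a \<Rightarrow> 'a \<Rightarrow> bool" where
  "jump C J a b \<longleftrightarrow> J \<noteq> [] \<and> ipath J \<and> set J \<inter> C = {} \<and>
     (\<forall>x\<in>set J. \<forall>c\<in>C. E x c \<longleftrightarrow> x = hd J \<and> c = a \<or> x = last J \<and> c = b)"

lemma jumpD:
  assumes "jump C J a b"
  shows "J \<noteq> []" "a \<in> C \<Longrightarrow> E (hd J) a" "b \<in> C \<Longrightarrow> E (last J) b" "x \<in> set J \<Longrightarrow> x \<notin> C" "ipath J"
  using assms unfolding jump_def by auto

lemma jump_ipath:
  assumes "jump C J a b" "a \<in> C" "b \<in> C" "a \<noteq> b" "\<not> E a b"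
  shows "ipath (a # J @ [b])"
proof -
  have J: "J \<noteq> []" "ipath J" "a \<notin> set J" "b \<notin> set J"
    "\<forall>x\<in>set J. E x a \<longleftrightarrow> x = hd J" "\<forall>x\<in>set J. E x b \<longleftrightarrow> x = last J"
    using assms unfolding jump_def by auto
  have "hd J \<in> set J" using J by simp
  then have "b \<noteq> hd J" using J by blast
  have "ipath (J @ [b])" using J by (subst ipath_append) auto
  moreover have "\<forall>x\<in>set J. E a x \<longleftrightarrow> x = hd J" using J Esym by blast
  ultimately show ?thesis using J assms \<open>b \<noteq> hd J\<close> by (subst ipath_Cons) auto
qed

lemma jump_glue:
  assumes "jump C J a b" "ipath (a # Q @ [b])" "set (a # Q @ [b]) \<subseteq> C" "Q \<noteq> []" "odd (length J + length Q)"
  shows "length J + length Q = 5"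
proof -
  have P0: "ipath (Q @ [b])" "a \<notin> set (Q @ [b])" "\<forall>z\<in>set (Q @ [b]). E a z \<longleftrightarrow> z = hd Q"
    using assms(2,4) ipath_Cons[of "Q @ [b]" a] by simp_all
  then have "b \<noteq> hd Q" "b \<notin> set Q" using ipath_distinct[OF P0(1)] assms(4) by auto
  then have ab: "a \<in> C" "b \<in> C" "a \<noteq> b" "\<not> E a b" "a \<notin> set Q" "b \<notin> set Q"
    using P0 assms(3) by auto
  show ?thesis
    using jump_ipath[OF assms(1) ab(1-4)] assms(2)
  proof (rule glue)
    show "J \<noteq> []" using assms(1) by (simp add: jump_def)
    show "set J \<inter> set Q = {}" using assms(1,3) unfolding jump_def by auto
    show "\<not> E x y" if "x \<in> set J" "y \<in> set Q" for x y
      using that assms(1,3) ab unfolding jump_def by auto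
  qed (use assms in auto)
qed

text \<open>The two arcs have 1 and 4 inner vertices. Gluing with the arc of the other parity leaves
  lengths 4 and 1, and a single vertex cannot have two neighbours on the hole.\<close>

lemma jump2:
  assumes "hole7 a b c d e f g" "jump C J a c" "C = {a,b,c,d,e,f,g}"
  shows "length J = 4"
proof -
  note ch = hole7_chords[OF assms(1)] hole7_edges[OF assms(1)]
  have dist: "distinct [a,b,c,d,e,f,g]" using assms(1) by (simp add: hole7_def)
  have 1: "ipath (a # [b] @ [c])" "ipath (a # [g,f,e,d] @ [c])" using ch dist by auto
  have "length J \<noteq> 1"
  proof
    assume "length J = 1"
    then obtain j where "J = [j]" by (auto simp: length_Suc_conv)
    then have "E j a" "E j c" "j \<notin> C" using jumpD[OF assms(2)] assms(3) by simp_all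
    then show False using hole7_nbr[OF assms(1), of j a c] assms(3) dist by simp
  qed
  moreover have "J \<noteq> []" using assms(2) by (simp add: jump_def)
  moreover have "even (length J) \<Longrightarrow> length J + 1 = 5"
    using jump_glue[OF assms(2) 1(1)] assms(3) by auto
  moreover have "odd (length J) \<Longrightarrow> length J + 4 = 5"
    using jump_glue[OF assms(2) 1(2)] assms(3) by auto
  ultimately show ?thesis by auto
qed

text \<open>The arcs have 2 and 3 inner vertices, which leaves lengths 3 and 2; length 2 would be
  two adjacent outside vertices that both attach to the hole.\<close>

lemma jump3:
  assumes "hole7 a b c d e f g" "jump C J a d" "C = {a,b,c,d,e,f,g}"
  shows "length J = 3"
proof -
  note ch = hole7_chords[OF assms(1)] hole7_edges[OF assms(1)]
  have dist: "distinct [a,b,c,d,e,f,g]" using assms(1) by (simp add: hole7_def)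
  have 1: "ipath (a # [b,c] @ [d])" "ipath (a # [g,f,e] @ [d])" using ch dist by auto
  have "length J \<noteq> 2"
  proof
    assume "length J = 2"
    then obtain j k where J: "J = [j,k]" by (auto simp: length_Suc_conv numeral_2_eq_2)
    then have "j \<notin> C" "k \<notin> C" "E j a" "E k d" "E j k" using jumpD[OF assms(2)] assms(3) by simp_all
    then show False using hole7_nbrs[OF assms(1), of j k a d] assms(3) by simp
  qed
  moreover have "odd (length J) \<Longrightarrow> length J + 2 = 5"
    using jump_glue[OF assms(2) 1(1)] assms(3) by auto
  moreover have "even (length J) \<Longrightarrow> length J + 3 = 5"
    using jump_glue[OF assms(2) 1(2)] assms(3) by auto
  ultimately show ?thesis by auto
qed

text \<open>
  Let \<open>K\<close> be the component of \<open>n\<close> after removing \<open>q2\<close> and the closed neighbourhoods of \<open>q1\<close> and \<open>q3\<close>.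
  Either \<open>K\<close> is attached to the rest of \<open>S\<close>, or its boundary lies in \<open>N(q1) \<union> N(q3)\<close> and, as neither
  star separates \<open>K\<close>, meets both. A detour may still be adjacent to \<open>q2\<close> in its middle part.
\<close>

lemma escape:
  assumes q: "E q1 q2" "E q2 q3" "q1 \<noteq> q3" and n: "E q2 n" "n \<notin> S" and S: "{q1,q2,q3} \<subseteq> S"
    and q2: "\<And>s. s \<in> S \<Longrightarrow> E q2 s \<Longrightarrow> s = q1 \<or> s = q3" and star_free: "star_free q1" "star_free q3"
  obtains (link) R z where "R \<noteq> []" "ipath R" "set R \<inter> S = {}"
      "\<And>r. r \<in> set R \<Longrightarrow> \<not> E r q1 \<and> \<not> E r q3 \<and> (E r q2 \<longleftrightarrow> r = hd R)"
      "z \<in> S - {q1,q2,q3}" "E (last R) z"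
      "\<And>r s. r \<in> set R \<Longrightarrow> r \<noteq> last R \<Longrightarrow> s \<in> S - {q1,q2,q3} \<Longrightarrow> \<not> E r s"
  | (detour) f M g where "M \<noteq> []" "ipath (q1 # f # M @ [g, q3])" "set (f # M @ [g]) \<inter> S = {}"
      "\<And>r s. r \<in> set M \<Longrightarrow> s \<in> S \<Longrightarrow> s \<noteq> q2 \<Longrightarrow> \<not> E r s"
proof -
  define S0 where "S0 = {v\<in>V. v \<noteq> q1 \<and> v \<noteq> q2 \<and> v \<noteq> q3 \<and> \<not> E q1 v \<and> \<not> E q3 v}"
  define K where "K = comp S0 n"
  define S' where "S' = S - {q1,q2,q3}"
  note q' = q(1,2)[THEN Esym]
  have "\<not> E q1 n" "\<not> E q3 n" using q q' n no3[of q1 q2 n] no3[of q3 q2 n] Esym by blast+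
  then have nS0: "n \<in> S0" using n S inV[OF n(1)] by (auto simp: S0_def)
  have KS0: "K \<subseteq> S0" "n \<in> K" "conn K" using nS0 comp_subset comp_self comp_conn by (auto simp: K_def)
  have closed: "z \<in> K" if "y \<in> K" "E y z" "z \<in> S0" for y z
    using that comp_closed[of y S0 n z] nS0 by (auto simp: K_def)
  have q13: "\<not> E q1 q3" using q q' no3[of q1 q2 q3] Esym by blast
  show thesis
  proof (cases "\<exists>k\<in>K. \<exists>s\<in>S'. E k s")
    case True
    then obtain k where k: "k \<in> K" "\<exists>s\<in>S'. E k s" by blast
    then have "reach K n k" using KS0 by (auto simp: conn_def)
    then obtain R where R: "ipath R" "R \<noteq> []" "set R \<subseteq> K" "E q2 (hd R)" "\<exists>s\<in>S'. E (last R) s"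
      "\<And>r. r \<in> set R \<Longrightarrow> E q2 r \<Longrightarrow> r = hd R" "\<And>r. r \<in> set R \<Longrightarrow> \<exists>s\<in>S'. E r s \<Longrightarrow> r = last R"
      using shortest_path[of K n k "{u. E q2 u}" "{u. \<exists>s\<in>S'. E u s}"] KS0 n k by (auto simp only: mem_Collect_eq)
    obtain z where z: "z \<in> S'" "E (last R) z" using R by blast
    \<comment> \<open>A vertex of \<open>S\<close> on \<open>R\<close> would not be the first one,
      as the first is a neighbour of \<open>q2\<close>; its predecessor would then already have a
      neighbour in \<open>S'\<close>, although only the last vertex of \<open>R\<close> has
      one.\<close>
    have RS: "r \<notin> S" if r: "r \<in> set R" for r
    proof
      assume rS: "r \<in> S"
      have r': "r \<in> S'" using r R(3) KS0 rS by (auto simp: S'_def S0_def)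
      have "r \<noteq> hd R" using q2[of r] rS R(4) r' by (auto simp: S'_def)
      obtain us vs where uv: "R = us @ r # vs" using r by (meson split_list)
      with \<open>r \<noteq> hd R\<close> have us: "us \<noteq> []" by auto
      have "E (last us) r" using R(1) us unfolding uv by (subst (asm) ipath_append) auto
      then have "\<exists>s\<in>S'. E (last us) s" using r' by blast
      moreover have "last us \<in> set R" using us uv by simp
      ultimately have "last us = last R" using R(7) by blast
      moreover have "last R \<in> set (r # vs)" "last us \<in> set us" using uv us by auto
      ultimately show False using ipath_distinct[OF R(1)] unfolding uv by auto
    qed
    show thesis
    proof (rule link[of R z])
      show "\<not> E r q1 \<and> \<not> E r q3 \<and> (E r q2 \<longleftrightarrow> r = hd R)" if "r \<in> set R" for r
        using that R(3,4) R(6)[of r] KS0(1) Esym unfolding S0_def by blast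
      show "\<not> E r s" if "r \<in> set R" "r \<noteq> last R" "s \<in> S - {q1,q2,q3}" for r s
        using that R(7)[of r] unfolding S'_def by blast
    qed (use R RS z in \<open>auto simp: S'_def\<close>)
  next
    case False
    have KS: "k \<notin> S" if "k \<in> K" for k
    proof
      assume "k \<in> S"
      then have kS': "k \<in> S'" using that KS0 by (auto simp: S'_def S0_def)
      have "reach K n k" using that KS0 by (auto simp: conn_def)
      moreover have "n \<noteq> k" using n \<open>k \<in> S\<close> by blast
      ultimately obtain u where "u \<in> K" "E u k"
        unfolding reach_def by (auto elim: rtranclp.cases)
      then show False using False kS' by blast
    qed
    have KV: "K \<subseteq> V" using KS0 by (auto simp: S0_def)
    \<comment> \<open>If the whole boundary of \<open>K\<close> lay in \<open>N(x)\<close>, then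
      \<open>K\<close> would be a component left by the star of \<open>x\<close>, with
      \<open>y\<close> as a vertex remaining elsewhere. So some boundary vertex is not a neighbour
      of \<open>x\<close>; being outside \<open>S0\<close>, it must be a neighbour of
      \<open>y\<close>.\<close>
    have side: "\<exists>a\<in>K. \<exists>g. E a g \<and> E y g \<and> \<not> E x g \<and> g \<notin> S \<and> g \<notin> K"
      if xy: "x = q1 \<and> y = q3 \<or> x = q3 \<and> y = q1" for x y
    proof -
      have "\<not> star_sep x K" using xy star_free by (auto simp: star_free_def)
      moreover have "x \<notin> K" "\<forall>a\<in>K. \<not> E x a" using xy KS0 by (auto simp: S0_def)
      moreover have "y \<in> V" "y \<notin> K" "y \<noteq> x" "\<not> E x y"
        using xy KS0 q q13 inV[OF q(1)] inV[OF q(2)] Esym by (auto simp: S0_def)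
      ultimately obtain a g where a: "a \<in> K" "E a g" "g \<notin> K" "\<not> E x g"
        using KS0 KV unfolding star_sep_def by blast
      have "g \<notin> S0" using closed a by blast
      moreover have "g \<noteq> q1" "g \<noteq> q3" using a KS0 Esym unfolding S0_def by blast+
      moreover have "g \<noteq> q2" using a xy q q' by auto
      ultimately have "E y g" "g \<notin> S'" using xy a inV[OF a(2)] False by (auto simp: S0_def)
      moreover have "g \<notin> S" using \<open>g \<notin> S'\<close> \<open>g \<noteq> q1\<close> \<open>g \<noteq> q2\<close> \<open>g \<noteq> q3\<close> by (auto simp: S'_def)
      ultimately show ?thesis using a by blast
    qed
    obtain b g where g: "b \<in> K" "E b g" "E q3 g" "\<not> E q1 g" "g \<notin> S" "g \<notin> K" using side[of q1 q3] by blast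
    obtain a f where f: "a \<in> K" "E a f" "E q1 f" "\<not> E q3 f" "f \<notin> S" "f \<notin> K" using side[of q3 q1] by blast
    have fg: "\<not> E f g" "f \<noteq> g" using f g q q' no5[of q1 f g q3 q2] Esym by blast+
    have "reach K a b" using f g KS0 by (auto simp: conn_def)
    then obtain M where M: "ipath M" "M \<noteq> []" "set M \<subseteq> K" "E f (hd M)" "E g (last M)"
      "\<And>r. r \<in> set M \<Longrightarrow> E f r \<Longrightarrow> r = hd M" "\<And>r. r \<in> set M \<Longrightarrow> E g r \<Longrightarrow> r = last M"
      using shortest_path[of K a b "{u. E f u}" "{u. E g u}"] f g Esym by (auto simp only: mem_Collect_eq)
    have MS0: "\<not> E q1 r" "\<not> E q3 r" "r \<noteq> q1" "r \<noteq> q3" if "r \<in> set M" for r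
      using that M(3) KS0 by (auto simp: S0_def)
    have ne: "q1 \<noteq> g" "q3 \<noteq> f" "q1 \<noteq> f" "q3 \<noteq> g" using f g neqE S by auto
    have "E r g \<longleftrightarrow> r = last M" if "r \<in> set M" for r using that M(5) M(7)[of r] Esym by blast
    moreover have "\<not> E r q3" if "r \<in> set M" for r using MS0[OF that] Esym by blast
    ultimately have 1: "ipath (M @ [g, q3])"
      using M(1,2,3) f g ne MS0 Esym[OF g(3)] by (subst ipath_append) auto
    moreover have "\<forall>r\<in>set M. E f r \<longleftrightarrow> r = hd M" using M by blast
    moreover have "\<not> E f q3" using f Esym by blast
    moreover have "g \<noteq> hd M" "q3 \<noteq> hd M" using M(2,3) g MS0 by (metis hd_in_set subsetD)+
    moreover have "f \<notin> set M" using M f by auto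
    ultimately have 2: "ipath (f # M @ [g, q3])"
      using M(2) f g fg ne by (subst ipath_Cons) auto
    have "ipath (q1 # f # M @ [g, q3])"
      using 2 f g q13 ne q(3) MS0 by (subst ipath_Cons) auto
    moreover have "\<not> E r s" if "r \<in> set M" "s \<in> S" "s \<noteq> q2" for r s
    proof -
      have "r \<in> K" using that M by blast
      then show ?thesis using that MS0[OF that(1)] False Esym unfolding S'_def by blast
    qed
    moreover have "set (f # M @ [g]) \<inter> S = {}" using f g M(3) KS by auto
    ultimately show thesis using detour[of M f g] M(2) by blast
  qed
qed

text \<open>Between \<open>a\<close> and \<open>d\<close> the hole and the jump form a theta with
  paths of 3, 4 and 4 edges. For each landing vertex \<open>z\<close>, one half of the jump extended
  by \<open>R\<close> is a jump whose length is known, which fixes \<open>length R\<close>; unless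
  \<open>z = f\<close>, a cycle of length at most 6 then appears on the side of the other
  half.\<close>

lemma theta344_link:
  assumes h: "hole7 a b c d e f g" and C: "C = {a,b,c,d,e,f,g}" and j: "jump C [q1,q2,q3] a d"
    and R: "R \<noteq> []" "ipath R" "set R \<inter> (C \<union> {q1,q2,q3}) = {}"
      "\<And>r. r \<in> set R \<Longrightarrow> \<not> E r q1 \<and> \<not> E r q3 \<and> (E r q2 \<longleftrightarrow> r = hd R)"
      "z \<in> C" "E (last R) z" "\<And>r s. r \<in> set R \<Longrightarrow> r \<noteq> last R \<Longrightarrow> s \<in> C \<Longrightarrow> \<not> E r s"
  shows "length R = 2 \<and> z = f"
proof -
  have dist: "distinct [a,b,c,d,e,f,g]" using h by (simp add: hole7_def)
  have q: "E q1 q2" "E q2 q3" "q1 \<noteq> q3" "q1 \<noteq> q2" "q2 \<noteq> q3" "\<not> E q1 q3" using j neqE by (auto simp: jump_def)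
  have qC: "q1 \<notin> C" "q2 \<notin> C" "q3 \<notin> C" using j by (auto simp: jump_def)
  have qE: "\<And>x. x \<in> C \<Longrightarrow> E q1 x \<longleftrightarrow> x = a" "\<And>x. x \<in> C \<Longrightarrow> E q3 x \<longleftrightarrow> x = d" "\<And>x. x \<in> C \<Longrightarrow> \<not> E q2 x"
    using j q by (auto simp: jump_def)
  have lR: "last R \<in> set R" "hd R \<in> set R" using R by auto
  have lz: "E (last R) x \<longleftrightarrow> x = z" if "x \<in> C" for x
    using hole7_nbr[OF h, of "last R" z x] R(3,5,6) lR that unfolding C by blast
  \<comment> \<open>Either half of the jump, continued along \<open>R\<close>, is a jump from
    \<open>a\<close> or \<open>d\<close> to \<open>z\<close>.\<close>
  have jj: "jump C (q # q2 # R) x z" if "q = q1 \<and> x = a \<or> q = q3 \<and> x = d" for q x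
  proof -
    have qq: "q \<noteq> q2" "E q q2" "q \<notin> C" "\<And>y. y \<in> C \<Longrightarrow> E q y \<longleftrightarrow> y = x" "q \<notin> set R" "\<forall>r\<in>set R. \<not> E q r"
      using that q qC qE R(3,4) Esym by blast+
    have qR: "q2 \<notin> set R" "\<forall>r\<in>set R. E q2 r \<longleftrightarrow> r = hd R" using R(3,4) Esym by blast+
    have "q2 \<noteq> hd R" using qR lR by blast
    have "ipath (q2 # R)" using R(1,2) qR by (simp add: ipath_Cons)
    then have "ipath (q # q2 # R)" using qq \<open>q2 \<noteq> hd R\<close> by (simp add: ipath_Cons[of "q2 # R"])
    moreover have "E y s \<longleftrightarrow> y = hd (q # q2 # R) \<and> s = x \<or> y = last (q # q2 # R) \<and> s = z"
      if "y \<in> set (q # q2 # R)" "s \<in> C" for y s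
    proof (cases "y \<in> set R")
      case True
      then show ?thesis using that qq(5) lz[of s] R(7)[of y s] R(1) by auto
    next
      case False
      then have "y \<noteq> last R" using lR by auto
      then show ?thesis using that False R(1) qq(1,4) qE(3) by auto
    qed
    ultimately show ?thesis using qC qq R(3) by (auto simp: jump_def)
  qed
  note j1 = jj[of q1 a, simplified] and j3 = jj[of q3 d, simplified]
  note rots = hole7_rots[OF h] hole7_rots[OF hole7_rev[OF h]]
  have hdR: "E (hd R) q2" "hd R \<noteq> q1" "hd R \<noteq> q3" using R lR by auto
  have E': "E q2 q1" "E q3 q2" "E a q1" "E d q3" "E q1 a" "E q3 d" using q qE(1)[of a] qE(2)[of d] Esym C by blast+
  have ed: "E a b" "E b a" "E c d" "E d c" "E d e" "E e d" "E g a" "E a g" using hole7_edges[OF h] by auto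
  have len1: "R = [hd R]" if "length R = 1" using that by (cases R) auto
  have len2: "R = [hd R, last R]" if "length R = 2" using that by (cases R; cases "tl R") auto
  have ne: "q2 \<noteq> x" "q1 \<noteq> x" "q3 \<noteq> x" "hd R \<noteq> x" "last R \<noteq> x" if "x \<in> C" for x
    using that qC R(3) lR by auto
  have lRE: "E z (last R)" using R(6) Esym by blast
  consider "z = a" | "z = b" | "z = c" | "z = d" | "z = e" | "z = f" | "z = g" using R(5) C by auto
  then show ?thesis
  proof cases
    case 1
    have "length (q3 # q2 # R) = 3" by (rule jump3[OF rots(9), where C=C]) (use j3 1 C in auto)
    then have "R = [hd R]" using len1 by simp
    then have "E a (hd R)" using lRE 1 by (metis last.simps)
    then show ?thesis using no4[of a "hd R" q2 q1] hdR E' ne[of a] C by auto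
  next
    case 2
    have "length (q3 # q2 # R) = 4" by (rule jump2[OF rots(9), where C=C]) (use j3 2 C in auto)
    then have l: "R = [hd R, last R]" using len2 by simp
    then have "E (hd R) (last R)" using R(2) by (metis ipath.simps(3))
    moreover have "q2 \<noteq> last R" using lR R(3) by auto
    ultimately show ?thesis using no6[of a q1 q2 "hd R" "last R" b] hdR(2) Esym[OF hdR(1)] E' q R(6) 2 ed ne[of a] ne[of b] C by auto
  next
    case 3
    have "length (q1 # q2 # R) = 4" by (rule jump2[OF h, where C=C]) (use j1 3 C in auto)
    then have l: "R = [hd R, last R]" using len2 by simp
    then have "E (hd R) (last R)" using R(2) by (metis ipath.simps(3))
    moreover have "q2 \<noteq> last R" using lR R(3) by auto
    ultimately show ?thesis using no6[of d q3 q2 "hd R" "last R" c] hdR(3) Esym[OF hdR(1)] E' q R(6) 3 ed ne[of d] ne[of c] C by auto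
  next
    case 4
    have "length (q1 # q2 # R) = 3" by (rule jump3[OF h, where C=C]) (use j1 4 C in auto)
    then have "R = [hd R]" using len1 by simp
    then have "E d (hd R)" using lRE 4 by (metis last.simps)
    then show ?thesis using no4[of d "hd R" q2 q3] hdR q E' ne[of d] C by auto
  next
    case 5
    have "length (q1 # q2 # R) = 3" by (rule jump3[OF rots(12), where C=C]) (use j1 5 C in auto)
    then have "R = [hd R]" using len1 by simp
    then have "E e (hd R)" using lRE 5 by (metis last.simps)
    then show ?thesis using no5[of d e "hd R" q2 q3] hdR q E' ed by auto
  next
    case 6
    have "length (q1 # q2 # R) = 4" by (rule jump2[OF rots(12), where C=C]) (use j1 6 C in auto)
    then show ?thesis using 6 by simp
  next
    case 7
    have "length (q3 # q2 # R) = 3" by (rule jump3[OF rots(3), where C=C]) (use j3 7 C in auto)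
    then have "R = [hd R]" using len1 by simp
    then have "E g (hd R)" using lRE 7 by (metis last.simps)
    then show ?thesis using no5[of a g "hd R" q2 q1] hdR q E' ed by auto
  qed
qed

text \<open>The link case of \<open>escape\<close> is settled by \<open>theta344_link\<close>; a
  detour around \<open>q2\<close> would turn the jump into one from \<open>a\<close> to
  \<open>d\<close> with more than three vertices.\<close>

lemma theta344:
  assumes h: "hole7 a b c d e f g" and C: "C = {a,b,c,d,e,f,g}" and j: "jump C [q1,q2,q3] a d"
    and star_free: "star_free q1" "star_free q3" and n: "E q2 n" "n \<noteq> q1" "n \<noteq> q3"
  obtains r1 r2 where "E q2 r1" "E r1 r2" "E r2 f" "r1 \<noteq> q1" "r1 \<noteq> q3" "r1 \<notin> C" "r2 \<notin> C" "r2 \<noteq> q2"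
proof -
  let ?S = "C \<union> {q1,q2,q3}"
  have q: "E q1 q2" "E q2 q3" "q1 \<noteq> q3" "\<not> E q1 q3" "q1 \<notin> C" "q2 \<notin> C" "q3 \<notin> C"
    "\<And>x. x \<in> C \<Longrightarrow> E q1 x \<longleftrightarrow> x = a" "\<And>x. x \<in> C \<Longrightarrow> E q3 x \<longleftrightarrow> x = d" "\<And>x. x \<in> C \<Longrightarrow> \<not> E q2 x"
    using j by (auto simp: jump_def)
  have S: "s = q1 \<or> s = q3" if "s \<in> ?S" "E q2 s" for s using that q(10)[of s] Eirr[of q2] by auto
  have "n \<notin> ?S" using S[of n] n by blast
  then show thesis
  proof (rule escape[OF q(1-3) n(1) _ _ S star_free])
    fix R z
    assume R: "R \<noteq> []" "ipath R" "set R \<inter> ?S = {}"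
      "\<And>r. r \<in> set R \<Longrightarrow> \<not> E r q1 \<and> \<not> E r q3 \<and> (E r q2 \<longleftrightarrow> r = hd R)"
      "z \<in> ?S - {q1,q2,q3}" "E (last R) z"
      "\<And>r s. r \<in> set R \<Longrightarrow> r \<noteq> last R \<Longrightarrow> s \<in> ?S - {q1,q2,q3} \<Longrightarrow> \<not> E r s"
    have "length R = 2 \<and> z = f"
    proof (rule theta344_link[OF h C j R(1-4) _ R(6)])
      show "\<not> E r s" if "r \<in> set R" "r \<noteq> last R" "s \<in> C" for r s
        using that R(7) q by blast
    qed (use R(5) in auto)
    then obtain r1 r2 where "R = [r1,r2]" "E r2 f" using R(6) by (auto simp: length_Suc_conv numeral_2_eq_2)
    then show thesis using that[of r1 r2] R(2,3) R(4)[of r1] Esym[of r1 q2] by auto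
  next
    fix x M y
    assume M: "M \<noteq> []" "ipath (q1 # x # M @ [y, q3])" "set (x # M @ [y]) \<inter> ?S = {}"
      "\<And>r s. r \<in> set M \<Longrightarrow> s \<in> ?S \<Longrightarrow> s \<noteq> q2 \<Longrightarrow> \<not> E r s"
    have "E q1 x" using M(2) by simp
    have "ipath (M @ [y, q3])" using ipath_appendD2[of "[q1,x]" "M @ [y,q3]"] M(2) by simp
    then have "E y q3" using ipath_appendD2 ipath.simps(3) by blast
    have ac: "a \<in> C" "d \<in> C" using C by auto
    have xC: "\<not> E x s" if "s \<in> C" for s
      using hole7_nbrs[OF h, of x q1 s a] that \<open>E q1 x\<close> q M(3) ac Esym unfolding C by auto
    have yC: "\<not> E y s" if "s \<in> C" for s
      using hole7_nbrs[OF h, of y q3 s d] that \<open>E y q3\<close> q M(3) ac unfolding C by auto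
    have "jump C (q1 # x # M @ [y, q3]) a d"
      unfolding jump_def
    proof (intro conjI ballI)
      fix u s assume u: "u \<in> set (q1 # x # M @ [y, q3])" "s \<in> C"
      have d: "distinct (q1 # x # M @ [y, q3])" using M(2) ipath_distinct by blast
      consider "u = q1" | "u = q3" | "u \<in> set (x # M @ [y])" using u(1) by auto
      then show "E u s \<longleftrightarrow> u = hd (q1 # x # M @ [y, q3]) \<and> s = a \<or> u = last (q1 # x # M @ [y, q3]) \<and> s = d"
      proof cases
        case 3
        then have "\<not> E u s" using u xC yC M(4)[of u s] q by auto
        then show ?thesis using 3 d by auto
      qed (use u q in auto)
    qed (use M q in auto)
    then have "length (q1 # x # M @ [y, q3]) = 3" by (rule jump3[OF h _ C])
    then show thesis by simp
  qed auto
qed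

text \<open>A walk can leave \<open>A\<close> only through a neighbour of \<open>x\<close>.\<close>

lemma stays_inside:
  assumes "\<forall>a\<in>A. \<forall>b. E a b \<longrightarrow> b \<in> A \<or> E x b"
  shows "successively E (a # p) \<Longrightarrow> a \<in> A \<Longrightarrow> \<forall>r\<in>set p. \<not> E x r \<Longrightarrow> set p \<subseteq> A"
proof (induction p arbitrary: a)
  case (Cons b p)
  then have "b \<in> A" using assms by auto
  then show ?case using Cons by auto
qed simp

text \<open>
  In the next lemma \<open>A\<close> is a component of the graph without \<open>N[x]\<close> that is rigid between \<open>y0\<close> and \<open>y5\<close>:
  every other way of leaving \<open>p2\<close> would give an induced path through \<open>A\<close> of the wrong length.
\<close>

lemma rigid_arm:
  assumes A: "\<forall>a\<in>A. \<not> E x a" "\<forall>a\<in>A. \<forall>b. E a b \<longrightarrow> b \<in> A \<or> E x b"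
    and star_free: "star_free p1" "star_free p3"
    and rigid0: "\<forall>L. ipath (y0 # L @ [y5]) \<longrightarrow> set L \<subseteq> A \<longrightarrow> length L = 4"
    and h: "hole7 x y0 p1 p2 p3 p4 y5" and P: "{p1,p2,p3,p4} \<subseteq> A"
    and n: "E p2 n" "n \<noteq> p1" "n \<noteq> p3"
  obtains r1 r2 w where "E p2 r1" "E r1 r2" "E r2 w" "E w x" "r1 \<in> A" "r2 \<in> A"
    "r1 \<noteq> p1" "r1 \<noteq> p3" "w \<noteq> y0" "w \<noteq> y5" "r2 \<noteq> p2" "w \<noteq> r1"
proof -
  note rigid = rigid0[rule_format]
  define C where C: "C = {x,y0,p1,p2,p3,p4,y5}"
  note ed = hole7_edges[OF h] and ch = hole7_chords[OF h]
  have dist: "distinct [x,y0,p1,p2,p3,p4,y5]" using h by (simp add: hole7_def)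
  have S: "s = p1 \<or> s = p3" if "s \<in> C" "E p2 s" for s using that ch Eirr[of p2] C by auto
  have nC: "n \<notin> C" using S n by blast
  have inC: "x \<in> C" "y0 \<in> C" "p1 \<in> C" "p2 \<in> C" "p3 \<in> C" "p4 \<in> C" "y5 \<in> C" using C by auto
  have pp: "E p1 p2" "E p2 p3" "p1 \<noteq> p3" "{p1,p2,p3} \<subseteq> C" using ed dist inC by auto
  show thesis
  proof (rule escape[OF pp(1-3) n(1) nC pp(4) S star_free])
    fix R z
    assume R: "R \<noteq> []" "ipath R" "set R \<inter> C = {}"
      "\<And>r. r \<in> set R \<Longrightarrow> \<not> E r p1 \<and> \<not> E r p3 \<and> (E r p2 \<longleftrightarrow> r = hd R)"
      "z \<in> C - {p1,p2,p3}" "E (last R) z"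
      "\<And>r s. r \<in> set R \<Longrightarrow> r \<noteq> last R \<Longrightarrow> s \<in> C - {p1,p2,p3} \<Longrightarrow> \<not> E r s"
    have lR: "last R \<in> set R" "hd R \<in> set R" using R(1) by simp_all
    then have lRC: "last R \<notin> C" "hd R \<notin> C" using R(3) by blast+
    have lC: "E (last R) s \<longleftrightarrow> s = z" if "s \<in> C" for s
      using hole7_nbr[OF h, of "last R" z s] that R(5,6) lRC(1) unfolding C by auto
    have RC: "E u s \<longleftrightarrow> u = hd R \<and> s = p2 \<or> u = last R \<and> s = z" if u: "u \<in> set R" "s \<in> C" for u s
    proof (cases "s \<in> {p1,p2,p3}")
      case True
      then show ?thesis using R(4)[OF u(1)] R(5) dist by auto
    next
      case False
      then show ?thesis using R(7)[OF u(1), of s] lC[OF u(2)] u(2) by auto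
    qed
    have CR: "E s u \<longleftrightarrow> u = hd R \<and> s = p2 \<or> u = last R \<and> s = z" if "u \<in> set R" "s \<in> C" for u s
      using RC[OF that] Esym by blast
    have walk: "successively E (p2 # R)"
      using ipath_successively[OF R(2)] CR[OF lR(2) inC(4)] by (simp add: successively_Cons)
    have p2A: "p2 \<in> A" using P by simp
    have RA: "set R \<subseteq> A" if "z \<noteq> x"
    proof (rule stays_inside[OF A(2) walk p2A])
      show "\<forall>r\<in>set R. \<not> E x r" using CR[of _ x] that inC dist by auto
    qed
    have nR: "s \<notin> set R" if "s \<in> C" for s using that R(3) by auto
    have zs: "z \<noteq> p1" "z \<noteq> p2" "z \<noteq> p3" using R(5) by auto
    have hR: "E p2 (hd R)" "E (hd R) p2" "E z (last R)" using RC[OF lR(2) inC(4)] CR[OF lR(2) inC(4)] R(6) Esym by blast+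
    have len1: "hd R = last R" if "length R = 1" using that by (cases R) auto
    consider "z = x" | "z = y0" | "z = p4" | "z = y5" using R(5) C by auto
    then show thesis
    proof cases
      \<comment> \<open>\<open>p2\<close> and \<open>x\<close> are at distance three on the hole, so
        \<open>R\<close> has three vertices.\<close>
      case 1
      have "jump C R p2 x" using R(1,2,3) RC 1 by (auto simp: jump_def)
      then have "length R = 3" by (rule jump3[OF hole7_rots(3)[OF hole7_rev[OF h]]]) (auto simp: C)
      then obtain r1 r2 w where Rr: "R = [r1,r2,w]" by (auto simp: length_Suc_conv numeral_3_eq_3)
      then have r: "E p2 r1" "E r1 r2" "E r2 w" "E w x" "\<not> E x r1" "\<not> E x r2" "w \<noteq> r1"
        using R(2,6) hR 1 CR[of r1 x] CR[of r2 x] inC dist by auto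
      then have "r1 \<in> A" using A(2) p2A by blast
      moreover then have "r2 \<in> A" using A(2) r by blast
      moreover have "r1 \<noteq> p1" "r1 \<noteq> p3" "w \<noteq> y0" "w \<noteq> y5" "r2 \<noteq> p2" using nR Rr inC by auto
      ultimately show thesis using that r by blast
    next
      \<comment> \<open>In the remaining cases \<open>R\<close> replaces \<open>p1\<close>, or
        \<open>p3\<close>, or both \<open>p3\<close> and \<open>p4\<close> on the path from
        \<open>y0\<close> to \<open>y5\<close>. Rigidity makes \<open>R\<close> as long as the piece
        it replaces, and the two together close a cycle of length 4, 4 or 6.\<close>
      case 2
      have "ipath (rev R)" using R(2) by (simp add: ipath_rev)
      moreover have "ipath [p2,p3,p4,y5]" using ed ch dist by auto
      ultimately have "ipath (rev R @ [p2,p3,p4,y5])"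
        using R(1) RC nR lR lRC inC zs 2 dist by (subst ipath_append) (auto simp: last_rev)
      then have "ipath (y0 # rev R @ [p2,p3,p4,y5])"
        using R(1) CR nR lR lRC inC 2 dist ch by (subst ipath_Cons) (auto simp: hd_rev)
      then have "length (rev R @ [p2,p3,p4]) = 4" using RA 2 dist P by (intro rigid) auto
      then have "hd R = last R" using len1 by simp
      then show thesis using no4[of y0 "hd R" p2 p1] hR 2 ed inC nR lR dist by auto
    next
      case 3
      have "ipath [y0,p1,p2]" "ipath [p4,y5]" using ed ch dist by auto
      moreover have "ipath (R @ [p4,y5])"
        using R(1,2) RC nR inC zs 3 dist ed by (subst ipath_append) auto
      ultimately have "ipath ([y0,p1,p2] @ R @ [p4,y5])"
        using R(1) CR nR lR lRC inC 3 dist ch by (subst ipath_append) auto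
      then have "ipath (y0 # ([p1,p2] @ R @ [p4]) @ [y5])" by simp
      then have "length ([p1,p2] @ R @ [p4]) = 4" using RA 3 dist P by (intro rigid) auto
      then have "hd R = last R" using len1 by simp
      then show thesis using no4[of p4 "hd R" p2 p3] hR 3 ed inC nR lR dist by auto
    next
      case 4
      have "ipath [y0,p1,p2]" using ed ch dist by auto
      moreover have "ipath (R @ [y5])"
        using R(1,2) RC nR inC zs 4 dist ed by (subst ipath_append) auto
      ultimately have "ipath ([y0,p1,p2] @ R @ [y5])"
        using R(1) CR nR lR lRC inC 4 dist ch by (subst ipath_append) auto
      then have "ipath (y0 # ([p1,p2] @ R) @ [y5])" by simp
      then have "length ([p1,p2] @ R) = 4" using RA 4 dist P by (intro rigid) auto
      then obtain r s where "R = [r,s]" by (auto simp: length_Suc_conv eval_nat_numeral)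
      then have "E p2 r" "E r s" "E s y5" "r \<noteq> p3" "r \<noteq> y5" "s \<noteq> p4" "s \<noteq> p2" using hR R(2,6) 4 nR inC by auto
      then show thesis using no6[of p2 r s y5 p4 p3] ed dist by auto
    qed
  next
    fix f M g
    assume M: "M \<noteq> []" "ipath (p1 # f # M @ [g, p3])" "set (f # M @ [g]) \<inter> C = {}"
      "\<And>r s. r \<in> set M \<Longrightarrow> s \<in> C \<Longrightarrow> s \<noteq> p2 \<Longrightarrow> \<not> E r s"
    have fg: "E p1 f" "f \<notin> C" "g \<notin> C" "set M \<inter> C = {}" using M(2,3) by auto
    have "ipath (M @ [g, p3])" using ipath_appendD2[of "[p1,f]" "M @ [g,p3]"] M(2) by simp
    then have gp: "E g p3" using ipath_appendD2 ipath.simps(3) by blast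
    have fC: "E f s \<longleftrightarrow> s = p1" if "s \<in> C" for s
      using hole7_nbr[OF h, of f p1 s] that fg Esym[OF fg(1)] unfolding C by auto
    have gC: "E g s \<longleftrightarrow> s = p3" if "s \<in> C" for s
      using hole7_nbr[OF h, of g p3 s] that fg gp unfolding C by auto
    have LC: "\<not> E u s \<and> \<not> E s u \<and> u \<noteq> s" if "u \<in> set (f # M @ [g])" "s \<in> {x,y0,p4,y5}" for u s
    proof -
      have "s \<in> C" "s \<noteq> p1" "s \<noteq> p2" "s \<noteq> p3" using that inC dist by auto
      then have "\<not> E u s \<and> u \<noteq> s" using that fC gC M(4)[of u s] fg by auto
      then show ?thesis using Esym by blast
    qed
    have w: "successively E (p1 # f # M @ [g])"
      using ipath_successively[OF M(2)] successively_append_iff[of E "p1 # f # M @ [g]" "[p3]"] by simp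
    have xL: "\<forall>r\<in>set (f # M @ [g]). \<not> E x r" using LC by blast
    have LA: "set (f # M @ [g]) \<subseteq> A"
      by (rule stays_inside[OF A(2) w _ xL]) (use P in auto)
    define L where "L = f # M @ [g]"
    have L: "ipath (p1 # L @ [p3])" "\<forall>u\<in>set L. u \<noteq> y0 \<and> \<not> E y0 u \<and> u \<noteq> p4 \<and> \<not> E u p4 \<and> u \<noteq> y5 \<and> \<not> E u y5" "set L \<subseteq> A"
    proof -
      show "ipath (p1 # L @ [p3])" "set L \<subseteq> A" using M(2) LA by (simp_all add: L_def)
      show "\<forall>u\<in>set L. u \<noteq> y0 \<and> \<not> E y0 u \<and> u \<noteq> p4 \<and> \<not> E u p4 \<and> u \<noteq> y5 \<and> \<not> E u y5"
        unfolding L_def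
      proof
        fix u assume "u \<in> set (f # M @ [g])"
        from LC[OF this, of y0] LC[OF this, of p4] LC[OF this, of y5]
        show "u \<noteq> y0 \<and> \<not> E y0 u \<and> u \<noteq> p4 \<and> \<not> E u p4 \<and> u \<noteq> y5 \<and> \<not> E u y5" by simp
      qed
    qed
    \<comment> \<open>Here \<open>L\<close> replaces \<open>p2\<close> but has at least three
      vertices, too many for rigidity.\<close>
    have "ipath ((p1 # L @ [p3]) @ [p4, y5])"
      using L ed ch dist by (subst ipath_append) auto
    then have "ipath (p1 # L @ [p3,p4,y5])" by simp
    then have "ipath (y0 # p1 # L @ [p3,p4,y5])"
      using L(2) ed ch dist by (subst ipath_Cons) auto
    then have "ipath (y0 # (p1 # L @ [p3,p4]) @ [y5])" by simp
    then have "length (p1 # L @ [p3,p4]) = 4" using L P by (intro rigid) auto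
    then show thesis by (simp add: L_def)
  qed auto
qed

end

section \<open>Heptagraphs without separating stars\<close>

text \<open>\<open>deg3\<close> expresses degree at least three in the form in which it is applied:
  \<open>x\<close> and \<open>y\<close> are the two neighbours already present in a
  configuration.\<close>

locale hepta_star_free = hepta +
  assumes deg3: "v \<in> V \<Longrightarrow> \<exists>n. E v n \<and> n \<noteq> x \<and> n \<noteq> y"
    and all_star_free: "star_free v"
begin

text \<open>\<open>theta344\<close> yields a path \<open>q2\<close>, \<open>r1\<close>,
  \<open>r2\<close>, \<open>f\<close>, which subdivides the theta further. A third neighbour of
  \<open>r1\<close> is then impossible: every link or detour creates a jump of the wrong length or a
  4-cycle.\<close>

lemma no_jump3:
  assumes h: "hole7 a b c d e f g" and j: "jump C J a d" and C: "C = {a,b,c,d,e,f,g}"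
  shows False
proof -
  have "length J = 3" by (rule jump3[OF h j C])
  then obtain q1 q2 q3 where J: "J = [q1,q2,q3]" by (auto simp: length_Suc_conv numeral_3_eq_3)
  note j = j[unfolded J]
  have q: "E q1 q2" "E q2 q3" "q1 \<noteq> q3" "\<not> E q1 q3" "q1 \<notin> C" "q2 \<notin> C" "q3 \<notin> C"
    "\<And>x. x \<in> C \<Longrightarrow> E q1 x \<longleftrightarrow> x = a" "\<And>x. x \<in> C \<Longrightarrow> E q3 x \<longleftrightarrow> x = d" "\<And>x. x \<in> C \<Longrightarrow> \<not> E q2 x"
    using j by (auto simp: jump_def)
  obtain n where "E q2 n" "n \<noteq> q1" "n \<noteq> q3" using deg3 inV[OF q(1)] by blast
  then obtain r1 r2 where r: "E q2 r1" "E r1 r2" "E r2 f" "r1 \<noteq> q1" "r1 \<noteq> q3" "r1 \<notin> C" "r2 \<notin> C" "r2 \<noteq> q2"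
    using theta344[OF h C j all_star_free all_star_free] by blast
  let ?S = "C \<union> {q1,q2,q3,r1,r2}"
  have aC: "a \<in> C" "d \<in> C" "f \<in> C" using C by auto
  \<comment> \<open>\<open>[x]\<close> would be a link with one vertex, whereas links from
    \<open>q2\<close> have two.\<close>
  have far: "\<not> E x s" if "E q2 x" "x \<notin> C" "x \<noteq> q1" "x \<noteq> q3" "s \<in> C" for x s
  proof
    assume "E x s"
    have "length [x] = 2 \<and> s = f"
      using that q neqE no3[of q1 q2 x] no3[of q2 x q3] \<open>E x s\<close>
      by (intro theta344_link[OF h C j]) (auto intro: Esym)
    then show False by simp
  qed
  have rq: "\<not> E r1 q1" "\<not> E r1 q3" using q r no3[of q1 q2 r1] no3[of q2 r1 q3] Esym by blast+
  have rq2: "\<not> E r2 q1" "\<not> E r2 q3"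
    using q r no4[of q1 q2 r1 r2] no4[of q3 q2 r1 r2] Esym by blast+
  have ne: "r1 \<noteq> q2" "r2 \<noteq> r1" "r2 \<noteq> q1" "r2 \<noteq> q3" using r rq neqE by blast+
  have r2C: "E r2 s \<longleftrightarrow> s = f" if "s \<in> C" for s
    using hole7_nbr[OF h, of r2 f s] r that aC unfolding C by auto
  have S: "s = q2 \<or> s = r2" if "s \<in> ?S" "E r1 s" for s
    using that far[of r1 s] r rq Eirr[of r1] by auto
  obtain n where n: "E r1 n" "n \<noteq> q2" "n \<noteq> r2" using deg3 inV[OF r(2)] by blast
  then have "n \<notin> ?S" using S by blast
  then show False
  proof (rule escape[OF r(1,2) r(8)[symmetric] n(1) _ _ S all_star_free all_star_free])
    fix R z
    assume R: "R \<noteq> []" "ipath R" "set R \<inter> ?S = {}"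
      "\<And>r. r \<in> set R \<Longrightarrow> \<not> E r q2 \<and> \<not> E r r2 \<and> (E r r1 \<longleftrightarrow> r = hd R)"
      "z \<in> ?S - {q2,r1,r2}" "E (last R) z"
      "\<And>r s. r \<in> set R \<Longrightarrow> r \<noteq> last R \<Longrightarrow> s \<in> ?S - {q2,r1,r2} \<Longrightarrow> \<not> E r s"
    have lR: "last R \<in> set R" "hd R \<in> set R" using R(1) by auto
    have lRS: "last R \<notin> ?S" using lR R(3) by blast
    have excl: "\<not> E (last R) s" if "s \<in> C" "E (last R) q" "q = q1 \<or> q = q3" for s q
      using that hole7_nbrs[OF h, of "last R" q s a] hole7_nbrs[OF h, of "last R" q s d] q(5,7,8,9) aC lRS
      unfolding C by auto
    have nlC: "\<not> E r s" if "r \<in> set R" "r \<noteq> last R" "s \<in> C" for r s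
      using R(7)[OF that(1,2), of s] that(3) q r by auto
    have r1R: "E r1 x \<longleftrightarrow> x = hd R" if "x \<in> set R" for x using R(4)[OF that] Esym by blast
    have r1R': "r1 \<notin> set R" using R(3) by auto
    have ip: "ipath (r1 # R)" using R(1,2) r1R r1R' by (simp add: ipath_Cons)
    \<comment> \<open>If \<open>R\<close> lands on \<open>C\<close>, then \<open>r1 # R\<close> is
      again a link from \<open>q2\<close> and ends at \<open>f\<close> like \<open>r1\<close>,
      \<open>r2\<close>. Otherwise it lands on \<open>q1\<close> or \<open>q3\<close>, which are
      treated together with their attachment \<open>a\<close> or \<open>d\<close>.\<close>
    consider "z \<in> C" | q x where "z = q" "q = q1 \<and> x = a \<or> q = q3 \<and> x = d" using R(5) by auto
    then show False
    proof cases
      case 1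
      then have lq: "\<not> E (last R) q1" "\<not> E (last R) q3" using excl[of z] R(6) by blast+
      have "length (r1 # R) = 2 \<and> z = f"
      proof (rule theta344_link[OF h C j _ ip _ _ 1])
        show "set (r1 # R) \<inter> (C \<union> {q1, q2, q3}) = {}" using R(3) r ne by auto
        show "E (last (r1 # R)) z" using R(1,6) by simp
        show "\<not> E x q1 \<and> \<not> E x q3 \<and> (E x q2 \<longleftrightarrow> x = hd (r1 # R))" if "x \<in> set (r1 # R)" for x
          using that rq lq R(4)[of x] R(7)[of x q1] R(7)[of x q3] r r1R' ne q Esym[OF r(1)] by (cases "x = last R") auto
        show "\<not> E x s" if "x \<in> set (r1 # R)" "x \<noteq> last (r1 # R)" "s \<in> C" for x s
          using that nlC[of x s] far[of r1 s] r R(1) by auto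
      qed simp
      then have *: "R = [hd R]" "E (hd R) f" using R(6) by (cases R; auto)+
      then have "E r1 (hd R)" using lR r1R by blast
      moreover have "hd R \<noteq> r2" "r1 \<noteq> f" using lR R(3) r aC by auto
      ultimately show False using no4[of r1 "hd R" f r2] * r Esym by blast
    next
      case 2
      then have q': "E q q2" "E q x" "q \<noteq> r1" "q \<notin> C" "\<not> E r1 q" "\<not> E r2 q" "q \<notin> set R" "r2 \<noteq> q" "x \<in> C" "q \<in> ?S - {q2,r1,r2}"
        "q \<noteq> q2" "\<And>s. s \<in> C \<Longrightarrow> E q s \<longleftrightarrow> s = x"
        using q r rq rq2 ne aC R(3) Esym neqE[of q1 q2] neqE[of q2 q3] by auto
      have lq: "E (last R) q" using 2 R(6) by simp
      have RC: "\<not> E y s" if "y \<in> set R" "s \<in> C" for y s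
        using that nlC[of y s] excl[OF that(2) lq] 2 by blast
      have "ipath (R @ [q])" using R(1,2) q' R(7)[of _ q] lq by (subst ipath_append) auto
      then have "ipath (r1 # R @ [q])" using r1R r1R' q' R(1) lR by (subst ipath_Cons) auto
      moreover have "r2 \<notin> set R" "\<forall>y\<in>set R. \<not> E r2 y" using R(3,4) Esym by blast+
      ultimately have ip2: "ipath (r2 # r1 # R @ [q])"
        using q' ne R(1) r Esym[OF r(2)] r1R' by (subst ipath_Cons) auto
      \<comment> \<open>Both \<open>a\<close> and \<open>d\<close> are at distance two from
        \<open>f\<close>, so this jump has four vertices and \<open>R\<close> only one.\<close>
      have "jump C (r2 # r1 # R @ [q]) f x"
        unfolding jump_def
      proof (intro conjI ballI)
        fix u s assume u: "u \<in> set (r2 # r1 # R @ [q])" "s \<in> C"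
        have d: "distinct (r2 # r1 # R @ [q])" using ip2 ipath_distinct by blast
        show "E u s \<longleftrightarrow> u = hd (r2 # r1 # R @ [q]) \<and> s = f \<or> u = last (r2 # r1 # R @ [q]) \<and> s = x"
          using u d r2C[of s] far[of r1 s] r RC[of u s] q'(12)[of s] by auto
      qed (use ip2 R(3) q' r in auto)
      then have j2: "jump C (r2 # r1 # R @ [q]) f x" .
      have "length (r2 # r1 # R @ [q]) = 4"
        using 2(2)
      proof (elim disjE conjE)
        assume "x = a"
        then show ?thesis using j2 by (intro jump2[OF hole7_rots(5)[OF h], where C=C]) (auto simp: C)
      next
        assume "x = d"
        then show ?thesis using j2 by (intro jump2[OF hole7_rots(1)[OF hole7_rev[OF h]], where C=C]) (auto simp: C)
      qed
      then have *: "R = [hd R]" using R(1) by (cases R) auto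
      then have "E (hd R) q" "E r1 (hd R)" using lq lR r1R by (metis last.simps, blast)
      moreover have "hd R \<noteq> q2" using lR R(3) by auto
      ultimately show False using no4[of r1 "hd R" q q2] q' r by blast
    qed
  next
    fix x M y
    assume M: "M \<noteq> []" "ipath (q2 # x # M @ [y, r2])" "set (x # M @ [y]) \<inter> ?S = {}"
      "\<And>r s. r \<in> set M \<Longrightarrow> s \<in> ?S \<Longrightarrow> s \<noteq> r1 \<Longrightarrow> \<not> E r s"
    have xy: "E q2 x" "x \<notin> C" "y \<notin> C" "x \<noteq> q1" "x \<noteq> q3" "q1 \<notin> set M" "y \<noteq> q1" using M(2,3) by auto
    have "ipath (M @ [y, r2])" using ipath_appendD2[of "[q2,x]" "M @ [y,r2]"] M(2) by simp
    then have "E y r2" using ipath_appendD2 ipath.simps(3) by blast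
    have yC: "\<not> E y s" if "s \<in> C" for s
      using hole7_nbrs[OF h, of y r2 s f] that \<open>E y r2\<close> r xy aC unfolding C by auto
    have "\<not> E q1 x" using no3[of q1 q2 x] q xy Esym by blast
    moreover have "\<not> E q1 y" using no5[of q1 q2 r1 r2 y] q r \<open>E y r2\<close> Esym by blast
    moreover have "\<not> E q1 r2" using rq2 Esym by blast
    moreover have "\<forall>m\<in>set M. \<not> E q1 m" using M(4)[of _ q1] r Esym by blast
    ultimately have ip: "ipath (q1 # q2 # x # M @ [y, r2])"
      using M(2) q xy ne neqE[OF q(1)] by (subst ipath_Cons) (auto simp: neqE)
    \<comment> \<open>Over distance two a jump has four vertices, but this one has at least
      six.\<close>
    have "jump C (q1 # q2 # x # M @ [y, r2]) a f"
      unfolding jump_def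
    proof (intro conjI ballI)
      fix u s assume u: "u \<in> set (q1 # q2 # x # M @ [y, r2])" "s \<in> C"
      have d: "distinct (q1 # q2 # x # M @ [y, r2])" using ip ipath_distinct by blast
      have "\<not> E u s" if "u \<in> set M" using M(4)[OF that, of s] u r by auto
      then show "E u s \<longleftrightarrow> u = hd (q1 # q2 # x # M @ [y, r2]) \<and> s = a \<or> u = last (q1 # q2 # x # M @ [y, r2]) \<and> s = f"
        using u d far[OF xy(1,2,4,5), of s] yC[of s] q(8,10)[of s] r2C[of s] by auto
    qed (use ip M(3) q r in auto)
    then have "length (q1 # q2 # x # M @ [y, r2]) = 4"
      by (rule jump2[OF hole7_rots(6)[OF hole7_rev[OF h]], where C=C]) (auto simp: C)
    then show False by simp
  qed auto
qed

text \<open>A third neighbour of \<open>q2\<close> cannot be continued. Links to \<open>C\<close>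
  mostly become jumps over distance three, on \<open>C\<close> or on a second 7-hole formed by the
  jump itself, and a detour makes the jump too long.\<close>

lemma no_jump2:
  assumes h: "hole7 a b c d e f g" and j: "jump C J a c" and C: "C = {a,b,c,d,e,f,g}"
  shows False
proof -
  have "length J = 4" by (rule jump2[OF h j C])
  then obtain q1 q2 q3 q4 where J: "J = [q1,q2,q3,q4]" by (auto simp: length_Suc_conv eval_nat_numeral)
  note j = j[unfolded J]
  have q: "E q1 q2" "E q2 q3" "E q3 q4" "q1 \<noteq> q3" "q2 \<noteq> q4" "q1 \<noteq> q4" "\<not> E q1 q3" "\<not> E q1 q4" "\<not> E q2 q4"
    "q1 \<notin> C" "q2 \<notin> C" "q3 \<notin> C" "q4 \<notin> C"
    "\<And>x. x \<in> C \<Longrightarrow> E q1 x \<longleftrightarrow> x = a" "\<And>x. x \<in> C \<Longrightarrow> E q4 x \<longleftrightarrow> x = c"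
    "\<And>x. x \<in> C \<Longrightarrow> \<not> E q2 x" "\<And>x. x \<in> C \<Longrightarrow> \<not> E q3 x"
    using j by (auto simp: jump_def)
  have q': "E q2 q1" "E q3 q2" "E q4 q3" "E q1 a" "E q4 c" "E a q1" "E c q4" "q2 \<noteq> q1" "q2 \<noteq> q3" "q3 \<noteq> q4"
    using q(1-3)[THEN Esym] q(1-3)[THEN neqE] q(14)[of a] q(15)[of c] Esym[of q1 a] Esym[of q4 c] C by auto
  have aC: "a \<in> C" "b \<in> C" "c \<in> C" using C by auto
  let ?S = "C \<union> {q1,q2,q3,q4}"
  let ?C' = "{a,b,c,q4,q3,q2,q1}"
  \<comment> \<open>The jump closes a second 7-hole with the short arc \<open>a\<close>,
    \<open>b\<close>, \<open>c\<close>.\<close>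
  have h': "hole7 a b c q4 q3 q2 q1" using h q(1-6,10-13) q' aC unfolding hole7_def C by auto
  have S: "s = q1 \<or> s = q3" if "s \<in> ?S" "E q2 s" for s using that q Eirr[of q2] by auto
  obtain n where n: "E q2 n" "n \<noteq> q1" "n \<noteq> q3" using deg3 inV[OF q(1)] by blast
  then have "n \<notin> ?S" using S by blast
  then show False
  proof (rule escape[OF q(1,2,4) n(1) _ _ S all_star_free all_star_free])
    fix R z
    assume R: "R \<noteq> []" "ipath R" "set R \<inter> ?S = {}"
      "\<And>r. r \<in> set R \<Longrightarrow> \<not> E r q1 \<and> \<not> E r q3 \<and> (E r q2 \<longleftrightarrow> r = hd R)"
      "z \<in> ?S - {q1,q2,q3}" "E (last R) z"
      "\<And>r s. r \<in> set R \<Longrightarrow> r \<noteq> last R \<Longrightarrow> s \<in> ?S - {q1,q2,q3} \<Longrightarrow> \<not> E r s"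
    have lR: "last R \<in> set R" "hd R \<in> set R" using R(1) by auto
    have lRS: "last R \<notin> ?S" "hd R \<notin> ?S" using lR R(3) by blast+
    have excl: "\<not> E (last R) s" if "s \<in> C" "E (last R) q4" for s
      using that hole7_nbrs[OF h, of "last R" q4 s c] q(13) q'(5) aC lRS unfolding C by auto
    have nl: "\<not> E r s" if "r \<in> set R" "r \<noteq> last R" "s \<in> C \<or> s = q4" for r s
      using R(7)[OF that(1,2), of s] that(3) q q' by auto
    have qR: "E q2 x \<longleftrightarrow> x = hd R" "\<not> E q1 x" "\<not> E q3 x" if "x \<in> set R" for x using R(4)[OF that] Esym by blast+
    have qR': "q1 \<notin> set R" "q2 \<notin> set R" "q3 \<notin> set R" "q4 \<notin> set R" using R(3) by auto
    have len1: "R = [hd R]" if "length R = 1" using that by (cases R) auto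
    have ip: "ipath (q2 # R)" using R(1,2) qR qR' by (simp add: ipath_Cons)
    have ip1: "ipath (q1 # q2 # R)" using ip q q' qR qR' by (subst ipath_Cons) auto
    show False
    proof (cases "z = q4")
      \<comment> \<open>\<open>R\<close> then bypasses \<open>q3\<close> inside the jump; the length
        4 leaves one vertex for \<open>R\<close> and hence a 4-cycle.\<close>
      case True
      then have lq: "E (last R) q4" using R(6) by simp
      have RC: "\<not> E y s" if "y \<in> set R" "s \<in> C" for y s
        using that nl[of y s] excl[OF that(2) lq] by blast
      have "E x q4 \<longleftrightarrow> x = last R" if "x \<in> set R" for x using nl[OF that] lq by blast
      then have "ipath ((q1 # q2 # R) @ [q4])"
        using ip1 q q' qR' R(1) lR(1) by (subst ipath_append) auto
      then have ip2: "ipath (q1 # q2 # R @ [q4])" by simp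
      have "jump C (q1 # q2 # R @ [q4]) a c"
        unfolding jump_def
      proof (intro conjI ballI)
        fix u s assume u: "u \<in> set (q1 # q2 # R @ [q4])" "s \<in> C"
        have d: "distinct (q1 # q2 # R @ [q4])" using ip2 ipath_distinct by blast
        show "E u s \<longleftrightarrow> u = hd (q1 # q2 # R @ [q4]) \<and> s = a \<or> u = last (q1 # q2 # R @ [q4]) \<and> s = c"
          using u d RC[of u s] q(14-16)[of s] by auto
      qed (use ip2 R(3) q in auto)
      then have "length (q1 # q2 # R @ [q4]) = 4" by (rule jump2[OF h _ C])
      then have *: "R = [hd R]" using len1 by simp
      then have "E (hd R) q4" using lq by (metis last.simps)
      moreover have "hd R \<noteq> q3" using lRS by auto
      ultimately show False using no4[of q2 "hd R" q4 q3] q q' qR lR by blast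
    next
      case False
      then have zC: "z \<in> C" using R(5) by auto
      then have l4: "\<not> E (last R) q4" using excl R(6) by blast
      have lC: "E (last R) s \<longleftrightarrow> s = z" if "s \<in> C" for s
        using hole7_nbr[OF h, of "last R" z s] that zC R(6) lRS unfolding C by auto
      have R4: "\<not> E x q4" if "x \<in> set R" for x using nl[OF that] l4 by blast
      have RC: "E x s \<longleftrightarrow> x = last R \<and> s = z" if "x \<in> set R" "s \<in> C" for x s
        using that nl[of x s] lC[of s] by blast
      have j1: "jump C (q1 # q2 # R) a z"
        unfolding jump_def
      proof (intro conjI ballI)
        fix u s assume u: "u \<in> set (q1 # q2 # R)" "s \<in> C"
        then show "E u s \<longleftrightarrow> u = hd (q1 # q2 # R) \<and> s = a \<or> u = last (q1 # q2 # R) \<and> s = z"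
          using RC[of u s] q(14-16)[of s] qR' q' R(1) lR by auto
      qed (use ip1 R(3) q in auto)
      have "ipath (q3 # q2 # R)" using ip q q' qR qR' lR by (subst ipath_Cons) auto
      moreover have "\<not> E q4 x" if "x \<in> set R" for x using R4[OF that] Esym by blast
      moreover have "\<not> E q4 q2" using q Esym by blast
      ultimately have ip3: "ipath (q4 # q3 # q2 # R)" using q q' qR' by (subst ipath_Cons) auto
      have j4: "jump C (q4 # q3 # q2 # R) c z"
        unfolding jump_def
      proof (intro conjI ballI)
        fix u s assume u: "u \<in> set (q4 # q3 # q2 # R)" "s \<in> C"
        then show "E u s \<longleftrightarrow> u = hd (q4 # q3 # q2 # R) \<and> s = c \<or> u = last (q4 # q3 # q2 # R) \<and> s = z"
          using RC[of u s] q(14-17)[of s] qR' q' R(1) lR by auto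
      qed (use ip3 R(3) q in auto)
      \<comment> \<open>On the second hole both \<open>b\<close> and \<open>c\<close> are at
        distance three from \<open>q2\<close>.\<close>
      have j': "jump ?C' R q2 z" if "z = b \<or> z = c"
        unfolding jump_def
      proof (intro conjI ballI)
        fix u s assume u: "u \<in> set R" "s \<in> ?C'"
        then show "E u s \<longleftrightarrow> u = hd R \<and> s = q2 \<or> u = last R \<and> s = z"
          using RC[of u s] R4[of u] R(4)[of u] aC zC q by auto
      qed (use R aC in auto)
      note rots = hole7_rots[OF h] hole7_rots[OF hole7_rev[OF h]]
      consider "z = a" | "z = b" | "z = c" | "z = d" | "z = e" | "z = f" | "z = g" using zC C by auto
      then show False
      proof cases
        case 1
        have "length (q4 # q3 # q2 # R) = 4" by (rule jump2[OF rots(10), where C=C]) (use j4 1 C in auto)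
        then have *: "R = [hd R]" using len1 by simp
        then have "E (hd R) a" using R(6) 1 by (metis last.simps)
        moreover have "hd R \<noteq> q1" "q2 \<noteq> a" using lRS q aC by auto
        ultimately show False using no4[of q2 "hd R" a q1] q q' qR lR by blast
      next
        case 2
        then show False using j' by (intro no_jump3[OF hole7_rots(5)[OF h'], where C="?C'"]) auto
      next
        case 3
        then show False using j' by (intro no_jump3[OF hole7_rots(1)[OF hole7_rev[OF h']], where C="?C'"]) auto
      next
        case 4
        then show False using j1 by (intro no_jump3[OF h, where C=C]) (auto simp: C)
      next
        case 5
        then show False using j1 by (intro no_jump3[OF rots(12), where C=C]) (auto simp: C)
      next
        case 6
        then show False using j4 by (intro no_jump3[OF rots(2), where C=C]) (auto simp: C)
      next
        case 7
        then show False using j4 by (intro no_jump3[OF rots(10), where C=C]) (auto simp: C)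
      qed
    qed
  next
    fix x M y
    assume M: "M \<noteq> []" "ipath (q1 # x # M @ [y, q3])" "set (x # M @ [y]) \<inter> ?S = {}"
      "\<And>r s. r \<in> set M \<Longrightarrow> s \<in> ?S \<Longrightarrow> s \<noteq> q2 \<Longrightarrow> \<not> E r s"
    have xy: "E q1 x" "x \<notin> C" "y \<notin> C" "q4 \<notin> set M" "y \<noteq> q4" "x \<noteq> q4" "y \<noteq> q4" using M(2,3) by auto
    have "ipath (M @ [y, q3])" using ipath_appendD2[of "[q1,x]" "M @ [y,q3]"] M(2) by simp
    then have y3: "E y q3" using ipath_appendD2 ipath.simps(3) by blast
    have xC: "\<not> E x s" if "s \<in> C" for s
      using hole7_nbrs[OF h, of x q1 s a] that Esym[OF xy(1)] q q' xy aC unfolding C by auto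
    have y4: "\<not> E y q4" using no3[of y q3 q4] q y3 Esym by blast
    \<comment> \<open>Unlike \<open>x\<close>, the vertex \<open>y\<close> is not next to an
      attached vertex, since \<open>q3\<close> has no neighbour on \<open>C\<close>. If
      \<open>y\<close> attaches to \<open>C\<close> at \<open>s\<close>, then \<open>q4\<close>,
      \<open>q3\<close>, \<open>y\<close> is a jump from \<open>c\<close> to \<open>s\<close> or
      closes a cycle of length 4 or 5.\<close>
    have yC: "\<not> E y s" if "s \<in> C" for s
    proof
      assume ys: "E y s"
      have u: "E y s' \<longleftrightarrow> s' = s" if "s' \<in> C" for s'
        using hole7_nbr[OF h, of y s s'] that ys \<open>s \<in> C\<close> xy unfolding C by auto
      have j: "jump C [q4,q3,y] c s"
        using u q(3,13) q(12,15,17) q'(3,10) xy Esym[OF y3] neqE[OF y3] y4 Esym[of q4 y] by (auto simp: jump_def)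
      note rots = hole7_rots[OF h] hole7_rots[OF hole7_rev[OF h]]
      consider "s = a" | "s = b" | "s = c" | "s = d" | "s = e" | "s = f" | "s = g" using \<open>s \<in> C\<close> C by auto
      then show False
      proof cases
        case 1
        then have "length [q4,q3,y] = 4" using j by (intro jump2[OF rots(10), where C=C]) (auto simp: C)
        then show False by simp
      next
        case 2
        then show False using no5[of c q4 q3 y b] q' y3 ys hole7_edges[OF h] Esym by blast
      next
        case 3
        then show False using no4[of c q4 q3 y] q' y3 ys xy q aC Esym by blast
      next
        case 4
        then show False using no5[of c q4 q3 y d] q' y3 ys hole7_edges[OF h] Esym by blast
      next
        case 5
        then have "length [q4,q3,y] = 4" using j by (intro jump2[OF rots(2), where C=C]) (auto simp: C)
        then show False by simp
      next
        case 6
        then show False using j by (intro no_jump3[OF rots(2), where C=C]) (auto simp: C)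
      next
        case 7
        then show False using j by (intro no_jump3[OF rots(10), where C=C]) (auto simp: C)
      qed
    qed
    have "\<not> E x q4" using no5[of q1 q2 q3 q4 x] q xy Esym by blast
    then have "ipath ((q1 # x # M @ [y, q3]) @ [q4])"
      using M(2) q q' y4 xy M(4)[of _ q4] by (subst ipath_append) auto
    then have ip: "ipath (q1 # x # M @ [y, q3, q4])" by simp
    have "jump C (q1 # x # M @ [y, q3, q4]) a c"
      unfolding jump_def
    proof (intro conjI ballI)
      fix u s assume u: "u \<in> set (q1 # x # M @ [y, q3, q4])" "s \<in> C"
      have d: "distinct (q1 # x # M @ [y, q3, q4])" using ip ipath_distinct by blast
      have "\<not> E u s" if "u \<in> set M" using M(4)[OF that, of s] u q by auto
      then show "E u s \<longleftrightarrow> u = hd (q1 # x # M @ [y, q3, q4]) \<and> s = a \<or> u = last (q1 # x # M @ [y, q3, q4]) \<and> s = c"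
        using u d xC[of s] yC[of s] q(14-17)[of s] by auto
    qed (use ip M(3) q in auto)
    then have "length (q1 # x # M @ [y, q3, q4]) = 4" by (rule jump2[OF h _ C])
    then show False by simp
  qed auto
qed

text \<open>A link from a third neighbour of \<open>a\<close> would be a jump over distance two or
  three, so \<open>escape\<close> leaves a detour from \<open>g\<close> to \<open>b\<close>. Its
  middle part must see \<open>a\<close>, as otherwise it is a jump itself, and has even length, as
  otherwise it closes an odd hole of length at least 9 with the arc through \<open>f\<close>,
  \<open>e\<close>, \<open>d\<close>, \<open>c\<close>.\<close>

lemma local_detour:
  assumes h: "hole7 a b c d e f g" and C: "C = {a,b,c,d,e,f,g}"
  obtains x M y where "M \<noteq> []" "ipath (g # x # M @ [y, b])" "set (x # M @ [y]) \<inter> C = {}"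
    "\<And>s. s \<in> C \<Longrightarrow> E x s \<longleftrightarrow> s = g" "\<And>s. s \<in> C \<Longrightarrow> E y s \<longleftrightarrow> s = b"
    "\<And>r s. r \<in> set M \<Longrightarrow> s \<in> C \<Longrightarrow> E r s \<Longrightarrow> s = a" "\<exists>r\<in>set M. E r a" "even (length M)"
proof -
  note ed = hole7_edges[OF h] and ch = hole7_chords[OF h]
  have dist: "distinct [a,b,c,d,e,f,g]" using h by (simp add: hole7_def)
  note rots = hole7_rots[OF h] hole7_rots[OF hole7_rev[OF h]]
  have S: "s = g \<or> s = b" if "s \<in> C" "E a s" for s using that ch Eirr[of a] C by auto
  obtain n where n: "E a n" "n \<noteq> g" "n \<noteq> b" using deg3[of a] inV[of a b] ed by blast
  have nC: "n \<notin> C" using S n by blast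
  have gab: "E g a" "E a b" "g \<noteq> b" "{g,a,b} \<subseteq> C" "a \<in> C" "b \<in> C" "g \<in> C" using ed dist C by auto
  show thesis
  proof (rule escape[OF gab(1-3) n(1) nC gab(4) S all_star_free all_star_free])
    fix R z
    assume R: "R \<noteq> []" "ipath R" "set R \<inter> C = {}"
      "\<And>r. r \<in> set R \<Longrightarrow> \<not> E r g \<and> \<not> E r b \<and> (E r a \<longleftrightarrow> r = hd R)"
      "z \<in> C - {g,a,b}" "E (last R) z"
      "\<And>r s. r \<in> set R \<Longrightarrow> r \<noteq> last R \<Longrightarrow> s \<in> C - {g,a,b} \<Longrightarrow> \<not> E r s"
    have lR: "last R \<in> set R" using R(1) by simp
    then have lRC: "last R \<notin> C" using R(3) by blast
    have lC: "E (last R) s \<longleftrightarrow> s = z" if "s \<in> C" for s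
      using hole7_nbr[OF h, of "last R" z s] that R(5,6) lRC unfolding C by auto
    have j: "jump C R a z"
      unfolding jump_def
    proof (intro conjI ballI)
      fix u s assume u: "u \<in> set R" "s \<in> C"
      show "E u s \<longleftrightarrow> u = hd R \<and> s = a \<or> u = last R \<and> s = z"
      proof (cases "s \<in> {g,a,b}")
        case True
        then show ?thesis using R(4)[OF u(1)] R(5) dist by auto
      next
        case False
        then show ?thesis using R(7)[OF u(1), of s] lC[OF u(2)] u(2) by auto
      qed
    qed (use R in auto)
    consider "z = c" | "z = d" | "z = e" | "z = f" using R(5) C by auto
    then show thesis
    proof cases
      case 1 then have False using j by (intro no_jump2[OF h, where C=C]) (auto simp: C) then show ?thesis ..
    next
      case 2 then have False using j by (intro no_jump3[OF h, where C=C]) (auto simp: C) then show ?thesis ..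
    next
      case 3 then have False using j by (intro no_jump3[OF rots(12), where C=C]) (auto simp: C) then show ?thesis ..
    next
      case 4 then have False using j by (intro no_jump2[OF rots(12), where C=C]) (auto simp: C) then show ?thesis ..
    qed
  next
    fix x M y
    assume M: "M \<noteq> []" "ipath (g # x # M @ [y, b])" "set (x # M @ [y]) \<inter> C = {}"
      "\<And>r s. r \<in> set M \<Longrightarrow> s \<in> C \<Longrightarrow> s \<noteq> a \<Longrightarrow> \<not> E r s"
    have xy: "E g x" "x \<notin> C" "y \<notin> C" using M(2,3) by auto
    have "ipath (M @ [y, b])" using ipath_appendD2[of "[g,x]" "M @ [y,b]"] M(2) by simp
    then have yb: "E y b" using ipath_appendD2 ipath.simps(3) by blast
    have xC: "E x s \<longleftrightarrow> s = g" if "s \<in> C" for s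
      using hole7_nbr[OF h, of x g s] that xy Esym[OF xy(1)] unfolding C by auto
    have yC: "E y s \<longleftrightarrow> s = b" if "s \<in> C" for s
      using hole7_nbr[OF h, of y b s] that xy yb unfolding C by auto
    have ip: "ipath (x # M @ [y])"
      using ipath_appendD1[of "x # M @ [y]" "[b]"] ipath_appendD2[of "[g]" "x # M @ [y,b]"] M(2) by simp
    then have dJ: "distinct (x # M @ [y])" by (rule ipath_distinct)
    have "\<exists>r\<in>set M. E r a"
    proof (rule ccontr)
      assume no: "\<not> ?thesis"
      have "jump C (x # M @ [y]) g b"
        unfolding jump_def
      proof (intro conjI ballI)
        fix u s assume u: "u \<in> set (x # M @ [y])" "s \<in> C"
        then show "E u s \<longleftrightarrow> u = hd (x # M @ [y]) \<and> s = g \<or> u = last (x # M @ [y]) \<and> s = b"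
          using xC[OF u(2)] yC[OF u(2)] M(4)[of u s] no dJ by auto
      qed (use ip M(3) in auto)
      then show False by (rule no_jump2[OF rots(6), where C=C]) (auto simp: C)
    qed
    moreover have "even (length M)"
    proof (rule ccontr)
      assume odd: "odd (length M)"
      have "length (x # M @ [y]) + length [f,e,d,c] = 5"
      proof (rule glue)
        show "ipath (g # (x # M @ [y]) @ [b])" using M(2) by simp
        show "ipath (g # [f,e,d,c] @ [b])" using ed ch dist by auto
        show "\<not> E u s" if u: "u \<in> set (x # M @ [y])" "s \<in> set [f,e,d,c]" for u s
        proof -
          have "s \<in> C" "s \<noteq> a" "s \<noteq> g" "s \<noteq> b" using u(2) dist C by auto
          then show ?thesis using u(1) xC[of s] yC[of s] M(4)[of u s] by auto
        qed
        show "set (x # M @ [y]) \<inter> set [f,e,d,c] = {}" using M(3) C by auto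
      qed (use odd in auto)
      then show False by simp
    qed
    moreover have "s = a" if "r \<in> set M" "s \<in> C" "E r s" for r s using M(4) that by blast
    ultimately show thesis using that[OF M(1-3) xC yC] by blast
  qed
qed

text \<open>If the two sets touched, a shortest path in their union between a neighbour of
  \<open>\<alpha>\<close> and a neighbour of \<open>\<beta>\<close> would be a jump.\<close>

lemma no_link:
  assumes P: "conn P" "P \<inter> C = {}" "\<And>p s. p \<in> P \<Longrightarrow> s \<in> C \<Longrightarrow> E p s \<Longrightarrow> s = \<alpha>" "p \<in> P" "E p \<alpha>"
    and Q: "conn Q" "Q \<inter> C = {}" "\<And>q s. q \<in> Q \<Longrightarrow> s \<in> C \<Longrightarrow> E q s \<Longrightarrow> s = \<beta>" "q \<in> Q" "E q \<beta>"
    and no: "\<And>J. \<not> jump C J \<alpha> \<beta>" and ab: "\<alpha> \<noteq> \<beta>"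
  shows "P \<inter> Q = {} \<and> (\<forall>u\<in>P. \<forall>v\<in>Q. \<not> E u v)"
proof (rule ccontr)
  assume "\<not> ?thesis"
  then have "\<exists>u\<in>P. \<exists>v\<in>Q. u = v \<or> E u v" by blast
  then obtain u v where uv: "u \<in> P" "v \<in> Q" "u = v \<or> E u v" by blast
  have "reach P p u" "reach Q v q" using P Q uv by (auto simp: conn_def)
  then have "reach (P \<union> Q) p u" "reach (P \<union> Q) v q" by (auto elim: reach_mono)
  moreover have "reach (P \<union> Q) u v" using uv reach_refl[of "P \<union> Q"] reach_step[of "P \<union> Q" u u v] by blast
  ultimately have "reach (P \<union> Q) p q" using reach_trans by blast
  then obtain J where J: "ipath J" "J \<noteq> []" "set J \<subseteq> P \<union> Q" "E (hd J) \<alpha>" "E (last J) \<beta>"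
    "\<And>r. r \<in> set J \<Longrightarrow> E r \<alpha> \<Longrightarrow> r = hd J" "\<And>r. r \<in> set J \<Longrightarrow> E r \<beta> \<Longrightarrow> r = last J"
    using shortest_path[of "P \<union> Q" p q "{u. E u \<alpha>}" "{u. E u \<beta>}"] P Q by (auto simp only: mem_Collect_eq Un_iff)
  have "jump C J \<alpha> \<beta>"
    unfolding jump_def
  proof (intro conjI ballI)
    fix u s assume u: "u \<in> set J" "s \<in> C"
    then have "E u s \<Longrightarrow> s = \<alpha> \<or> s = \<beta>" using J(3) P(3)[of u s] Q(3)[of u s] by blast
    then show "E u s \<longleftrightarrow> u = hd J \<and> s = \<alpha> \<or> u = last J \<and> s = \<beta>"
      using J(4,5) J(6,7)[OF u(1)] by blast
  qed (use J P(2) Q(2) in auto)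
  then show False using no by blast
qed

text \<open>The detours are taken around \<open>a\<close> and \<open>d\<close>. Their attachments
  \<open>g\<close>, \<open>a\<close>, \<open>b\<close> and \<open>c\<close>, \<open>d\<close>,
  \<open>e\<close> are pairwise at distance two or three except for the adjacent pair
  \<open>b\<close>, \<open>c\<close>, where only the single vertices \<open>y\<close> and
  \<open>x'\<close> attach.\<close>

theorem no_hole7:
  assumes h: "hole7 a b c d e f g"
  shows False
proof -
  define C where C: "C = {a,b,c,d,e,f,g}"
  note ed = hole7_edges[OF h] and ch = hole7_chords[OF h]
  have dist: "distinct [a,b,c,d,e,f,g]" using h by (simp add: hole7_def)
  note rots = hole7_rots[OF h] hole7_rots[OF hole7_rev[OF h]]
  have C': "C = {d,e,f,g,a,b,c}" unfolding C by auto
  obtain x M y where M: "M \<noteq> []" "ipath (g # x # M @ [y, b])" "set (x # M @ [y]) \<inter> C = {}"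
    "\<And>s. s \<in> C \<Longrightarrow> E x s \<longleftrightarrow> s = g" "\<And>s. s \<in> C \<Longrightarrow> E y s \<longleftrightarrow> s = b"
    "\<And>r s. r \<in> set M \<Longrightarrow> s \<in> C \<Longrightarrow> E r s \<Longrightarrow> s = a" "\<exists>r\<in>set M. E r a" "even (length M)"
    by (rule local_detour[OF h C]) (rule that; assumption)
  obtain x' M' y' where M': "M' \<noteq> []" "ipath (c # x' # M' @ [y', e])" "set (x' # M' @ [y']) \<inter> C = {}"
    "\<And>s. s \<in> C \<Longrightarrow> E x' s \<longleftrightarrow> s = c" "\<And>s. s \<in> C \<Longrightarrow> E y' s \<longleftrightarrow> s = e"
    "\<And>r s. r \<in> set M' \<Longrightarrow> s \<in> C \<Longrightarrow> E r s \<Longrightarrow> s = d" "\<exists>r\<in>set M'. E r d" "even (length M')"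
    by (rule local_detour[OF rots(3) C']) (rule that; assumption)
  have inC: "a \<in> C" "b \<in> C" "c \<in> C" "d \<in> C" "e \<in> C" "f \<in> C" "g \<in> C" using C by auto
  have nj1: "\<not> jump C J a d" for J by (rule notI, rule no_jump3[OF h, where C=C]) (use C in auto)
  have nj2: "\<not> jump C J a c" for J by (rule notI, rule no_jump2[OF h, where C=C]) (use C in auto)
  have nj3: "\<not> jump C J a e" for J by (rule notI, rule no_jump3[OF rots(12), where C=C]) (use C in auto)
  have nj4: "\<not> jump C J g d" for J by (rule notI, rule no_jump3[OF hole7_rev[OF h], where C=C]) (use C in auto)
  have nj5: "\<not> jump C J g e" for J by (rule notI, rule no_jump2[OF hole7_rev[OF h], where C=C]) (use C in auto)
  have nj6: "\<not> jump C J b d" for J by (rule notI, rule no_jump2[OF rots(1), where C=C]) (use C in auto)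
  have nj7: "\<not> jump C J b e" for J by (rule notI, rule no_jump3[OF rots(1), where C=C]) (use C in auto)
  have nj8: "\<not> jump C J g c" for J by (rule notI, rule no_jump3[OF rots(6), where C=C]) (use C in auto)
  note nj = nj1 nj2 nj3 nj4 nj5 nj6 nj7 nj8
  have cM: "conn (set M)" "conn (set M')"
    using M(1,2) M'(1,2) ipath_appendD2[of "[g,x]" "M @ [y,b]"] ipath_appendD1[of M "[y,b]"]
      ipath_appendD2[of "[c,x']" "M' @ [y',e]"] ipath_appendD1[of M' "[y',e]"]
    by (auto intro: conn_ipath)
  have c1: "conn {u}" for u by (simp add: conn_def reach_refl)
  have disj: "x \<notin> C" "y \<notin> C" "set M \<inter> C = {}" "x' \<notin> C" "y' \<notin> C" "set M' \<inter> C = {}"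
    using M(3) M'(3) by auto
  obtain m m' where m: "m \<in> set M" "E m a" "m' \<in> set M'" "E m' d" using M(7) M'(7) by blast
  have "E x g" "E y b" "E x' c" "E y' e" using M(4,5) M'(4,5) inC by auto
  note xx = this
  have an: "a \<noteq> d" "a \<noteq> c" "a \<noteq> e" "g \<noteq> d" "g \<noteq> e" "b \<noteq> d" "b \<noteq> e" "g \<noteq> c" using dist by auto
  have s1: "set M \<inter> set M' = {} \<and> (\<forall>u\<in>set M. \<forall>v\<in>set M'. \<not> E u v)"
    by (rule no_link[OF cM(1) disj(3) M(6) m(1,2) cM(2) disj(6) M'(6) m(3,4) nj(1) an(1)]) auto
  have s2: "set M \<inter> {x'} = {} \<and> (\<forall>u\<in>set M. \<forall>v\<in>{x'}. \<not> E u v)"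
    by (rule no_link[OF cM(1) disj(3) M(6) m(1,2) c1 _ _ _ xx(3) nj(2) an(2)]) (use disj M' in auto)
  have s3: "set M \<inter> {y'} = {} \<and> (\<forall>u\<in>set M. \<forall>v\<in>{y'}. \<not> E u v)"
    by (rule no_link[OF cM(1) disj(3) M(6) m(1,2) c1 _ _ _ xx(4) nj(3) an(3)]) (use disj M' in auto)
  have s4: "{x} \<inter> set M' = {} \<and> (\<forall>u\<in>{x}. \<forall>v\<in>set M'. \<not> E u v)"
    by (rule no_link[OF c1 _ _ _ xx(1) cM(2) disj(6) M'(6) m(3,4) nj(4) an(4)]) (use disj M in auto)
  have s5: "{y} \<inter> set M' = {} \<and> (\<forall>u\<in>{y}. \<forall>v\<in>set M'. \<not> E u v)"
    by (rule no_link[OF c1 _ _ _ xx(2) cM(2) disj(6) M'(6) m(3,4) nj(6) an(6)]) (use disj M in auto)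
  have s7: "{x} \<inter> {y'} = {} \<and> (\<forall>u\<in>{x}. \<forall>v\<in>{y'}. \<not> E u v)"
    by (rule no_link[OF c1 _ _ _ xx(1) c1 _ _ _ xx(4) nj(5) an(5)]) (use disj M M' in auto)
  \<comment> \<open>End vertices of the two detours are all attached to the hole, so
    \<open>hole7_nbrs\<close> applies to every pair, including the one at \<open>b\<close> and
    \<open>c\<close> that no jump excludes.\<close>
  have s6: "\<not> E u v \<and> u \<noteq> v" if "u = x \<or> u = y" "v = x' \<or> v = y'" for u v
  proof
    show "\<not> E u v" using that hole7_nbrs[OF h, of u v] disj xx inC unfolding C by auto
    show "u \<noteq> v" using that M(4,5)[of c] M(4,5)[of e] xx inC dist by auto
  qed
  define W where "W = y' # rev M' @ [x']"
  have ipr: "ipath (e # W @ [c])" using M'(2) ipath_rev[of "c # x' # M' @ [y', e]"] by (simp add: W_def)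
  have W: "\<not> E u s \<and> u \<noteq> s" if "u \<in> set W" "s \<in> {f,g,b}" for u s
    using that M'(3) M'(4,5)[of s] M'(6)[of u s] inC dist by (auto simp: W_def)
  have Wb: "\<forall>u\<in>set W. u \<noteq> b \<and> \<not> E u b" using W by blast
  have Wf: "\<forall>u\<in>set W. u \<noteq> f \<and> \<not> E f u" "\<forall>u\<in>set W. u \<noteq> g \<and> \<not> E g u" using W Esym by blast+
  have Wc: "c \<notin> set W" "e \<notin> set W" using M'(3) inC by (auto simp: W_def)
  have bc: "E c b" "\<not> E e b" "b \<noteq> c" "b \<noteq> e" "e \<noteq> c" using ed ch dist by auto
  have 1: "ipath (e # W @ [c, b])"
    using ipr Wb Wc bc ipath_append[of "e # W @ [c]" "[b]"] by auto
  have fb: "E f e" "\<not> E f c" "\<not> E f b" "f \<noteq> e" "f \<noteq> c" "f \<noteq> b" "e \<noteq> c"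
    "E g f" "\<not> E g e" "\<not> E g c" "\<not> E g b" "g \<noteq> f" "g \<noteq> e" "g \<noteq> c" "g \<noteq> b" using ed ch dist by auto
  have 2: "ipath (f # e # W @ [c, b])"
    using 1 Wf fb Wc bc by auto
  then have ipQ: "ipath (g # f # e # y' # rev M' @ [x', c, b])"
    using Wf fb Wc bc by (auto simp: W_def)
  \<comment> \<open>As \<open>M\<close> and \<open>M'\<close> have even length, the two paths from
    \<open>g\<close> to \<open>b\<close> have different parity, and together they are far too long
    for a 7-hole.\<close>
  have "length (x # M @ [y]) + length (f # e # y' # rev M' @ [x', c]) = 5"
  proof (rule glue)
    show "ipath (g # (x # M @ [y]) @ [b])" using M(2) by simp
    show "ipath (g # (f # e # y' # rev M' @ [x', c]) @ [b])" using ipQ by simp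
    show "set (x # M @ [y]) \<inter> set (f # e # y' # rev M' @ [x', c]) = {}"
    proof -
      have "x' \<notin> set M" "y' \<notin> set M" "x \<notin> set M'" "y \<notin> set M'" "set M \<inter> set M' = {}"
        using conjunct1[OF s1] conjunct1[OF s2] conjunct1[OF s3] conjunct1[OF s4] conjunct1[OF s5] by simp_all
      moreover have "x \<noteq> x'" "x \<noteq> y'" "y \<noteq> x'" "y \<noteq> y'"
        using s6[of x x'] s6[of x y'] s6[of y x'] s6[of y y'] by simp_all
      moreover have "s \<noteq> x \<and> s \<noteq> y \<and> s \<notin> set M" if "s \<in> {f,e,c}" for s using that M(3) inC by auto
      ultimately show ?thesis by auto
    qed
    show "\<not> E u v" if u: "u \<in> set (x # M @ [y])" "v \<in> set (f # e # y' # rev M' @ [x', c])" for u v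
    proof (cases "v \<in> {f,e,c}")
      case True
      then have "v \<in> C" "v \<noteq> a" "v \<noteq> g" "v \<noteq> b" using inC dist by auto
      then show ?thesis using u(1) M(4,5)[of v] M(6)[of u v] by auto
    next
      case False
      then have "v \<in> {x',y'} \<union> set M'" "u \<in> {x,y} \<union> set M" using u by auto
      then show ?thesis
        using conjunct2[OF s1] conjunct2[OF s2] conjunct2[OF s3] conjunct2[OF s4] conjunct2[OF s5] s6[of u v] by auto
    qed
  qed (use M(8) M'(8) in auto)
  then show False by simp
qed

end

section \<open>Minimal graphs that are not 3-colourable\<close>

locale crit = hepta +
  assumes noncol: "\<not> col V c"
    and mincol: "W \<subset> V \<Longrightarrow> \<exists>c. col W c"
begin

text \<open>If all neighbours of \<open>v\<close> are among \<open>x\<close> and \<open>y\<close>, a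
  colouring of the rest leaves one of three colours for \<open>v\<close>.\<close>

lemma degree3:
  assumes "v \<in> V" shows "\<exists>n. E v n \<and> n \<noteq> x \<and> n \<noteq> y"
proof (rule ccontr)
  assume no: "\<not> ?thesis"
  have "V - {v} \<subset> V" using assms by auto
  then obtain c where c: "col (V - {v}) c" using mincol by blast
  have "\<exists>k\<in>{1,2,3::nat}. k \<noteq> c x \<and> k \<noteq> c y" by simp presburger
  then obtain k where k: "k \<in> {1,2,3::nat}" "k \<noteq> c x" "k \<noteq> c y" by blast
  have "col V (c(v := k))"
    unfolding col_def
  proof (intro conjI ballI impI)
    fix u w assume u: "u \<in> V" "w \<in> V" "E u w"
    then have "u \<noteq> w" "E w u" using Eirr Esym by auto
    then show "(c(v := k)) u \<noteq> (c(v := k)) w"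
      using u c k no unfolding col_def by (cases "u = v"; cases "w = v") force+
  qed (use c k in \<open>auto simp: col_def\<close>)
  then show False using noncol by blast
qed

text \<open>Both sides are colourable by minimality, and a transposition of colours makes the two
  colourings agree at \<open>y\<close>. A \<open>y\<close> outside \<open>V\<close> gives
  connectedness as a special case.\<close>

lemma no_cut_vertex:
  assumes U: "U \<noteq> {}" "U \<subseteq> V" "\<And>u b. u \<in> U \<Longrightarrow> E u b \<Longrightarrow> b \<in> U \<or> b = y" and t: "t \<in> V" "t \<notin> U" "t \<noteq> y"
  shows False
proof -
  have "U \<union> ({y} \<inter> V) \<subset> V" "V - U \<subset> V" using U t by auto
  then obtain c1 c2 where c: "col (U \<union> ({y} \<inter> V)) c1" "col (V - U) c2" using mincol by meson
  have "\<exists>c1. col (U \<union> ({y} \<inter> V)) c1 \<and> (y \<in> V - U \<longrightarrow> c1 y = c2 y)"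
  proof (cases "y \<in> V - U")
    case True
    then have "col (U \<union> ({y} \<inter> V)) (\<lambda>u. swp (c1 y) (c2 y) (c1 u))"
      using c by (intro col_swp) (auto simp: col_def)
    then show ?thesis by (intro exI[of _ "\<lambda>u. swp (c1 y) (c2 y) (c1 u)"]) (auto simp: swp_def)
  next
    case False
    then show ?thesis using c by blast
  qed
  then obtain c3 where c3: "col (U \<union> ({y} \<inter> V)) c3" "y \<in> V - U \<Longrightarrow> c3 y = c2 y" by blast
  define c where "c u = (if u \<in> U then c3 u else c2 u)" for u
  have cross: "c u \<noteq> c w" if "u \<in> U" "w \<in> V" "w \<notin> U" "E u w" for u w
  proof -
    have "w = y" using U(3) that by blast
    then show ?thesis using that c3 U(2) by (auto simp: c_def col_def)
  qed
  have "col V c"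
    unfolding col_def
  proof (intro conjI ballI impI)
    fix u w assume u: "u \<in> V" "w \<in> V" "E u w"
    consider "u \<in> U" "w \<in> U" | "u \<notin> U" "w \<notin> U" | "u \<in> U" "w \<notin> U" | "u \<notin> U" "w \<in> U" by blast
    then show "c u \<noteq> c w"
    proof cases
      case 1 then show ?thesis using c3(1) u by (auto simp: c_def col_def)
    next
      case 2 then show ?thesis using c(2) u by (auto simp: c_def col_def)
    next
      case 3 then show ?thesis using cross[of u w] u by auto
    next
      case 4 then show ?thesis using cross[of w u] u Esym[OF u(3)] by auto
    qed
  qed (use c c3 U in \<open>auto simp: c_def col_def\<close>)
  then show False using noncol by blast
qed

text \<open>
  If all induced paths on the other side of the star between neighbours of \<open>x\<close> were even, Kempe
  exchanges on both sides would give all common attachments the same colour. An odd path there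
  forces all paths through \<open>A\<close> with the same ends to be odd, and each closes a 7-hole with \<open>x\<close>.
\<close>

lemma rigid_pair:
  assumes star_sep: "star_sep x A"
  obtains y y' where "E x y" "E x y'" "y \<noteq> y'" "\<exists>a\<in>A. E y a" "\<exists>a\<in>A. E y' a"
    "\<And>L. ipath (y # L @ [y']) \<Longrightarrow> set L \<subseteq> A \<Longrightarrow> length L = 4"
proof -
  obtain t where A: "conn A" "A \<subseteq> V" "x \<notin> A" "\<And>a. a \<in> A \<Longrightarrow> \<not> E x a" "\<And>a b. a \<in> A \<Longrightarrow> E a b \<Longrightarrow> b \<in> A \<or> E x b"
    and t: "t \<in> V" "t \<notin> A" "t \<noteq> x" "\<not> E x t"
    using star_sep unfolding star_sep_def by blast
  have Ane: "A \<noteq> {}" using A(1) by (auto simp: conn_def)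
  \<comment> \<open>A centre outside \<open>V\<close> has no neighbours, so \<open>A\<close> would
    have no boundary at all.\<close>
  have xV: "x \<in> V"
    using no_cut_vertex[OF Ane A(2) _ t(1-3)] A(5) inV by blast
  define YA where "YA = {b. b \<notin> A \<and> (\<exists>a\<in>A. E a b)}"
  have YA: "E x b" if "b \<in> YA" for b using that A(5) by (auto simp: YA_def)
  define Z where "Z = V - A - YA - {x}"
  define Z' where "Z' = comp Z t"
  have tZ: "t \<in> Z" using t YA by (auto simp: Z_def)
  have Z': "conn Z'" "Z' \<subseteq> Z" "t \<in> Z'" using tZ comp_conn comp_subset comp_self by (auto simp: Z'_def)
  define Y where "Y = {y\<in>YA. \<exists>z\<in>Z'. E y z}"
  have bd: "b \<in> Z' \<or> b \<in> Y \<or> b = x" if "z \<in> Z'" "E z b" for z b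
  proof (rule ccontr)
    assume no: "\<not> ?thesis"
    then have "b \<notin> Z" using comp_closed[of z Z t b] that tZ by (auto simp: Z'_def)
    then have "b \<in> A \<or> b \<in> YA" using no inV[OF that(2)] by (auto simp: Z_def)
    moreover have "b \<notin> YA" using no that Esym[OF that(2)] by (auto simp: Y_def)
    moreover have "b \<notin> A" using that Z'(2) Esym[OF that(2)] by (auto simp: Z_def YA_def)
    ultimately show False by blast
  qed
  have Yx: "E x y" if "y \<in> Y" for y using that YA by (auto simp: Y_def)
  have YV: "Y \<subseteq> V" using inV by (auto simp: Y_def)
  have YZ: "Y \<inter> Z' = {}" using Z'(2) by (auto simp: Y_def Z_def)
  have xZ: "x \<notin> Z'" "x \<notin> Y" using Z'(2) Yx Eirr by (auto simp: Z_def)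
  have nadj: "\<not> E y y'" if "y \<in> Y" "y' \<in> Y" for y y' using no3[of x y y'] Yx that Esym by blast
  \<comment> \<open>\<open>Y\<close> consists of the common attachments of \<open>A\<close> and of
    the component \<open>Z'\<close> of \<open>t\<close>.\<close>
  have "\<exists>y\<in>Y. \<exists>y'\<in>Y. \<exists>L. ipath (y # L @ [y']) \<and> set L \<subseteq> Z' \<and> even (length L)"
  proof (rule ccontr)
    assume no: "\<not> ?thesis"
    \<comment> \<open>\<open>W1\<close> and \<open>W2\<close> are proper subsets that cover
      \<open>V\<close> and meet exactly in \<open>Y\<close> and \<open>x\<close>; no edge runs
      between their differences.\<close>
    define W1 where "W1 = V - Z'"
    define W2 where "W2 = Z' \<union> Y \<union> {x}"
    have AW2: "A \<inter> W2 = {}" using Z'(2) A(3) by (auto simp: W2_def Z_def Y_def YA_def)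
    have "Z' \<subseteq> V" using Z'(2) by (auto simp: Z_def)
    then have "W1 \<subset> V" "W2 \<subset> V" using AW2 Ane A(2) Z'(3) YV xV by (auto simp: W1_def W2_def)
    then obtain c1 c2 where c: "col W1 c1" "col W2 c2" using mincol by meson
    have W1: "Y \<subseteq> W1" "x \<in> W1" and W2: "Y \<subseteq> W2" "x \<in> W2" using YZ YV xV xZ by (auto simp: W1_def W2_def)
    \<comment> \<open>Giving \<open>x\<close> colour 1 on both sides keeps it off the chains in
      colours 2 and 3.\<close>
    have normal: "\<exists>c'. col W c' \<and> c' x = 1" if "col W c" "x \<in> W" for W c
      using col_swp[OF that(1), of "c x" 1] that
      by (intro exI[of _ "\<lambda>u. swp (c x) 1 (c u)"]) (auto simp: col_def swp_def)
    obtain d1 d2 where d: "col W1 d1" "d1 x = 1" "col W2 d2" "d2 x = 1"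
      using normal[OF c(1) W1(2)] normal[OF c(2) W2(2)] by blast
    have "\<exists>c'. col W2 c' \<and> (\<forall>y\<in>Y. c' y \<noteq> 3) \<and> (\<forall>w\<in>W2. d2 w \<noteq> 2 \<and> d2 w \<noteq> 3 \<longrightarrow> c' w = d2 w)"
    proof (rule kempe[OF d(3) W2(1)])
      fix y y' L assume L: "y \<in> Y" "y' \<in> Y" "ipath (y # L @ [y'])" "set L \<subseteq> W2 - Y" "even (length L)"
        "\<forall>u\<in>set L. d2 u = 2 \<or> d2 u = 3"
      have "x \<notin> set L" using L(6) d(4) by auto
      then have "set L \<subseteq> Z'" using L(4) by (auto simp: W2_def)
      then show False using no L by blast
    qed auto
    then obtain e2 where e2: "col W2 e2" "\<And>y. y \<in> Y \<Longrightarrow> e2 y \<noteq> 3" "e2 x = 1" using d(4) W2 by auto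
    \<comment> \<open>A chain \<open>L\<close> with an even number of inner vertices would be glued
      to a path \<open>P\<close> through \<open>Z'\<close>, which is odd by assumption. The lengths
      would sum to 5, but each is at least 4 by the girth at \<open>x\<close>.\<close>
    have "\<exists>c'. col W1 c' \<and> (\<forall>y\<in>Y. c' y \<noteq> 3) \<and> (\<forall>w\<in>W1. d1 w \<noteq> 2 \<and> d1 w \<noteq> 3 \<longrightarrow> c' w = d1 w)"
    proof (rule kempe[OF d(1) W1(1)])
      fix y y' L assume L: "y \<in> Y" "y' \<in> Y" "ipath (y # L @ [y'])" "set L \<subseteq> W1 - Y" "even (length L)"
        "\<forall>u\<in>set L. d1 u = 2 \<or> d1 u = 3"
      have xL: "x \<notin> set L" using L(6) d(2) by auto
      have yy: "y \<noteq> y'" using ipath_distinct[OF L(3)] by auto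
      have Lne: "L \<noteq> []" using L(3) nadj[OF L(1,2)] by (cases L) auto
      obtain z z' where z: "z \<in> Z'" "E y z" "z' \<in> Z'" "E y' z'" using L(1,2) by (auto simp: Y_def)
      have "reach Z' z z'" using z Z'(1) by (auto simp: conn_def)
      then obtain P where P: "ipath P" "P \<noteq> []" "set P \<subseteq> Z'" "E y (hd P)" "E y' (last P)"
        "\<And>r. r \<in> set P \<Longrightarrow> E y r \<Longrightarrow> r = hd P" "\<And>r. r \<in> set P \<Longrightarrow> E y' r \<Longrightarrow> r = last P"
        using shortest_path[of Z' z z' "{u. E y u}" "{u. E y' u}"] z by (auto simp only: mem_Collect_eq)
      have yP: "y \<notin> set P" "y' \<notin> set P" using P(3) L(1,2) YZ by auto
      have "hd P \<in> set P" using P(2) by simp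
      then have "y' \<noteq> hd P" using yP by blast
      have "E r y' \<longleftrightarrow> r = last P" if "r \<in> set P" for r using P(5) P(7)[OF that] Esym by blast
      then have "ipath (P @ [y'])" using P(1,2) yP by (subst ipath_append) auto
      moreover have "E y r \<longleftrightarrow> r = hd P" if "r \<in> set P" for r using P(4) P(6)[OF that] by blast
      ultimately have ipP: "ipath (y # P @ [y'])"
        using P(2) yP yy nadj[OF L(1,2)] \<open>y' \<noteq> hd P\<close> by (subst ipath_Cons) auto
      then have "odd (length P)" using no L(1,2) P(3) by blast
      have PL: "\<not> E u v" if "u \<in> set P" "v \<in> set L" for u v
        using bd[of u v] that P(3) L(4) xL unfolding W1_def by blast
      have "length P + length L = 5"
        using \<open>odd (length P)\<close> L(5) P(3) L(4) PL by (intro glue[OF ipP L(3) P(2) Lne]) (auto simp: W1_def)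
      moreover have xy: "E x y" "E x y'" "x \<noteq> y" "x \<noteq> y'" using Yx L(1,2) xZ by auto
      have "4 \<le> length P" using path_girth[OF ipP xy(1,2)] P(3) xZ xy by auto
      moreover have "4 \<le> length L" using path_girth[OF L(3) xy(1,2)] xL xy by auto
      ultimately show False by simp
    qed auto
    then obtain e1 where e1: "col W1 e1" "\<And>y. y \<in> Y \<Longrightarrow> e1 y \<noteq> 3" "e1 x = 1" using d(2) W1 by auto
    \<comment> \<open>On \<open>Y\<close> colour 3 has been removed and colour 1 is taken by
      \<open>x\<close>, so both colourings are constantly 2 there.\<close>
    have eq: "e1 b = e2 b" if "b \<in> Y \<or> b = x" for b
    proof (cases "b = x")
      case True then show ?thesis using e1 e2 by simp
    next
      case False
      then have b: "b \<in> Y" "E x b" using that Yx by auto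
      then have "b \<in> W1" "b \<in> W2" using W1 W2 by auto
      then have "e1 x \<noteq> e1 b" "e2 x \<noteq> e2 b" "e1 b \<in> {1,2,3}" "e2 b \<in> {1,2,3}"
        using b(2) e1(1) e2(1) W1(2) W2(2) unfolding col_def by blast+
      then show ?thesis using e1(2)[OF b(1)] e2(2)[OF b(1)] e1(3) e2(3) by auto
    qed
    define c where "c u = (if u \<in> Z' then e2 u else e1 u)" for u
    have cross: "c u \<noteq> c w" if "u \<in> Z'" "w \<in> V" "w \<notin> Z'" "E u w" for u w
    proof -
      have w: "w \<in> Y \<or> w = x" using bd that by blast
      then have "e2 u \<noteq> e2 w" using e2(1) that by (auto simp: col_def W2_def)
      then show ?thesis using eq[OF w] that by (simp add: c_def)
    qed
    have "col V c"
      unfolding col_def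
    proof (intro conjI ballI impI)
      fix u w assume u: "u \<in> V" "w \<in> V" "E u w"
      consider "u \<in> Z'" "w \<in> Z'" | "u \<notin> Z'" "w \<notin> Z'" | "u \<in> Z'" "w \<notin> Z'" | "u \<notin> Z'" "w \<in> Z'" by blast
      then show "c u \<noteq> c w"
      proof cases
        case 1 then show ?thesis using e2(1) u by (auto simp: c_def col_def W2_def)
      next
        case 2 then show ?thesis using e1(1) u by (auto simp: c_def col_def W1_def)
      next
        case 3 then show ?thesis using cross[of u w] u by auto
      next
        case 4 then show ?thesis using cross[of w u] u Esym[OF u(3)] by auto
      qed
    qed (use e1 e2 in \<open>auto simp: c_def col_def W1_def W2_def\<close>)
    then show False using noncol by blast
  qed
  then obtain y y' L0 where L0: "y \<in> Y" "y' \<in> Y" "ipath (y # L0 @ [y'])" "set L0 \<subseteq> Z'" "even (length L0)" by blast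
  have yy: "y \<noteq> y'" using ipath_distinct[OF L0(3)] by auto
  have L0ne: "L0 \<noteq> []" using L0(3) nadj[OF L0(1,2)] by (cases L0) auto
  have xy: "E x y" "E x y'" "x \<noteq> y" "x \<noteq> y'" "E y x" using Yx L0(1,2) xZ Esym by auto
  have att: "\<exists>a\<in>A. E u a" "u \<notin> A" if "u \<in> Y" for u using that Esym by (auto simp: Y_def YA_def)
  have "length L = 4" if L: "ipath (y # L @ [y'])" "set L \<subseteq> A" for L
  proof -
    have Lne: "L \<noteq> []" using L(1) nadj[OF L0(1,2)] by (cases L) auto
    have LL0: "\<not> E u v" if "u \<in> set L0" "v \<in> set L" for u v
      using bd[of u v] that L0(4) L(2) A(3) att Z'(2) unfolding Z_def by blast
    have xL: "x \<notin> set L" "x \<notin> set L0" using L(2) L0(4) A(3) xZ by auto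
    have "4 \<le> length L" using path_girth[OF L(1) xy(1,2)] xL xy by auto
    moreover have "4 \<le> length L0" using path_girth[OF L0(3) xy(1,2)] xL xy by auto
    moreover have "odd (length L) \<Longrightarrow> length L0 + length L = 5"
      using L0(4,5) L(2) LL0 Z'(2) by (intro glue[OF L0(3) L(1) L0ne Lne]) (auto simp: Z_def)
    ultimately have "even (length L)" by auto
    \<comment> \<open>The path through \<open>x\<close> alone has one inner vertex, so gluing with
      it gives 4 + 1 = 5.\<close>
    have "ipath (y # [x] @ [y'])" using xy yy nadj[OF L0(1,2)] by auto
    then have "length L + length [x] = 5"
      using \<open>even (length L)\<close> L(2) xL A(4) Esym by (intro glue[OF L(1) _ Lne]) auto
    then show ?thesis by simp
  qed
  then show thesis using that[of y y'] xy yy att L0(1,2) by blast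
qed

text \<open>After colouring \<open>V - {v}\<close>, an exchange freeing colour 2 on
  \<open>N(v)\<close> would extend the colouring to \<open>v\<close>. The path that obstructs it has
  an even number of inner vertices and closes an odd hole with \<open>v\<close>.\<close>

lemma exists_hole7: "\<exists>a b c d e f g. hole7 a b c d e f g"
proof -
  have "V \<noteq> {}" using noncol[of "\<lambda>_. 1"] by (auto simp: col_def)
  then obtain v where v: "v \<in> V" by blast
  then have "V - {v} \<subset> V" by auto
  then obtain c where c: "col (V - {v}) c" using mincol by blast
  define Y where "Y = {y. E v y}"
  have YV: "Y \<subseteq> V - {v}" using inV Eirr by (auto simp: Y_def)
  have "\<exists>y\<in>Y. \<exists>y'\<in>Y. \<exists>L. ipath (y # L @ [y']) \<and> set L \<subseteq> V - {v} - Y \<and> even (length L)"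
  proof (rule ccontr)
    assume no: "\<not> ?thesis"
    have "\<exists>c'. col (V - {v}) c' \<and> (\<forall>y\<in>Y. c' y \<noteq> 2) \<and> (\<forall>w\<in>V - {v}. c w \<noteq> 1 \<and> c w \<noteq> 2 \<longrightarrow> c' w = c w)"
      by (rule kempe[OF c YV]) (use no in auto)
    then obtain c' where c': "col (V - {v}) c'" "\<forall>y\<in>Y. c' y \<noteq> 2" by blast
    have "col V (c'(v := 2))"
      unfolding col_def
    proof (intro conjI ballI impI)
      fix u w assume u: "u \<in> V" "w \<in> V" "E u w"
      then have "u \<noteq> w" "E w u" using Eirr Esym by auto
      then show "(c'(v := 2)) u \<noteq> (c'(v := 2)) w"
        using u c' unfolding col_def Y_def by (cases "u = v"; cases "w = v") auto
    qed (use c' in \<open>auto simp: col_def\<close>)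
    then show False using noncol by blast
  qed
  then obtain y y' L where L: "E v y" "E v y'" "ipath (y # L @ [y'])" "set L \<subseteq> V - {v} - Y" "even (length L)"
    by (auto simp: Y_def)
  have yy: "y \<noteq> y'" using ipath_distinct[OF L(3)] by auto
  have "\<not> E y y'" using no3[of v y y'] L Esym by blast
  then have Lne: "L \<noteq> []" using L(3) by (cases L) auto
  have vy: "v \<noteq> y" "v \<noteq> y'" "E y v" using L Esym Eirr by auto
  have "\<not> E u v" if "u \<in> set L" for u using that L(4) Esym by (auto simp: Y_def)
  then have "length L + length [v] = 5"
    using L vy yy \<open>\<not> E y y'\<close> by (intro glue[OF L(3) _ Lne]) auto
  then have "length L = 4" by simp
  then obtain a b c d where "L = [a,b,c,d]" by (auto simp: length_Suc_conv eval_nat_numeral)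
  then have "hole7 v y a b c d y'"
    using L(3,4) vy yy L(2) Esym[OF L(2)] L(1) ipath_distinct[OF L(3)] unfolding hole7_def by auto
  then show ?thesis by blast
qed

text \<open>Outside \<open>A\<close>, the star of \<open>w\<close> reaches only common neighbours of
  \<open>w\<close> and \<open>x\<close>, of which there is at most one since 4-cycles are absent.
  Hence all vertices outside \<open>A\<close> and off the star stay connected to \<open>x\<close>,
  and a component not containing \<open>x\<close> would be a proper subset of
  \<open>A\<close>.\<close>

lemma star_free_in_smallest:
  assumes star_sep: "star_sep x A" and least: "\<And>x' A'. star_sep x' A' \<Longrightarrow> card A \<le> card A'" and w: "w \<in> A"
  shows "star_free w"
  unfolding star_free_def
proof (intro allI notI)
  fix A' assume star_sep': "star_sep w A'"
  have A: "conn A" "A \<subseteq> V" "x \<notin> A" "\<And>a. a \<in> A \<Longrightarrow> \<not> E x a" "\<And>a b. a \<in> A \<Longrightarrow> E a b \<Longrightarrow> b \<in> A \<or> E x b"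
    using star_sep unfolding star_sep_def by blast+
  obtain t where A': "conn A'" "A' \<subseteq> V" "w \<notin> A'" "\<And>a. a \<in> A' \<Longrightarrow> \<not> E w a" "\<And>a b. a \<in> A' \<Longrightarrow> E a b \<Longrightarrow> b \<in> A' \<or> E w b"
    and t: "t \<in> V" "t \<notin> A'" "t \<noteq> w" "\<not> E w t"
    using star_sep' unfolding star_sep_def by blast
  obtain y y' where y: "E x y" "\<exists>a\<in>A. E y a" using rigid_pair[OF star_sep] by metis
  then have xV: "x \<in> V" using inV by blast
  define N where "N = V - {u. u = w \<or> E w u}"
  define Z where "Z = N - A"
  have xw: "\<not> E w x" "x \<noteq> w" using A(3,4) w Esym by blast+
  then have xZ: "x \<in> Z" using xV A(3) by (auto simp: Z_def N_def)
  have Zconn: "reach Z z x" if z: "z \<in> Z" for z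
  proof (rule ccontr)
    assume no: "\<not> ?thesis"
    define U where "U = comp Z z"
    \<comment> \<open>The unique common neighbour of \<open>w\<close> and \<open>x\<close>; if there
      is none, \<open>w\<close> is a default value that is different from \<open>x\<close>.\<close>
    define y0 where "y0 = (if \<exists>b. E w b \<and> E x b then SOME b. E w b \<and> E x b else w)"
    have y0: "b = y0" if "E w b" "E x b" for b
    proof -
      have "E w y0 \<and> E x y0" using that someI[of "\<lambda>b. E w b \<and> E x b" b] unfolding y0_def by auto
      then show ?thesis using no4[of w b x y0] that xw Esym by blast
    qed
    have "x \<noteq> y0"
    proof (cases "\<exists>b. E w b \<and> E x b")
      case True
      then have "E x y0" using someI_ex[OF True] by (simp add: y0_def)
      then show ?thesis using Eirr by blast
    next
      case False
      then have "y0 = w" unfolding y0_def by (rule if_not_P)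
      then show ?thesis using xw by simp
    qed
    have U: "U \<subseteq> Z" "z \<in> U" "x \<notin> U" using z comp_subset comp_self no by (auto simp: U_def comp_def)
    have "b \<in> U \<or> b = y0" if u: "u \<in> U" "E u b" for u b
    proof (rule ccontr)
      assume nb: "\<not> ?thesis"
      then have "b \<notin> Z" using comp_closed[of u Z z b] u z by (auto simp: U_def)
      then consider "b \<in> A" | "b = w" | "E w b" "b \<notin> A" using inV[OF u(2)] by (auto simp: Z_def N_def)
      then show False
      proof cases
        case 1
        then have "E x u" using A(5)[OF 1 Esym[OF u(2)]] u U(1) by (auto simp: Z_def)
        then have "x \<in> U" using comp_closed[of u Z z x] u z xZ Esym by (auto simp: U_def)
        then show False using U by blast
      next
        case 2
        then show False using u U(1) Esym by (auto simp: Z_def N_def)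
      next
        case 3
        then have "E x b" using A(5)[OF w] by blast
        then show False using y0 3 nb by blast
      qed
    qed
    then show False using no_cut_vertex[of U y0 x] U \<open>x \<noteq> y0\<close> xV by (auto simp: Z_def N_def)
  qed
  have small: False if B: "star_sep w B" "x \<notin> B" for B
  proof -
    have B': "B \<subseteq> N" "w \<notin> B" "\<And>a b. a \<in> B \<Longrightarrow> E a b \<Longrightarrow> b \<in> N \<Longrightarrow> b \<in> B"
      using B(1) unfolding star_sep_def N_def by blast+
    have "u \<notin> Z" if "u \<in> B" for u
    proof
      assume "u \<in> Z"
      then have "x \<in> B" using reach_closed[OF Zconn that] B'(3) by (auto simp: Z_def)
      then show False using B(2) by blast
    qed
    then have "B \<subset> A" using B' w by (auto simp: Z_def)
    then have "card B < card A" using A(2) fin by (meson finite_subset psubset_card_mono)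
    then show False using least[OF B(1)] by simp
  qed
  show False
  proof (cases "x \<in> A'")
    case False
    then show False using small[OF star_sep'] by blast
  next
    \<comment> \<open>The component of \<open>t\<close> avoids \<open>x\<close> and can take the
      place of \<open>A'\<close>.\<close>
    case True
    have tN: "t \<in> N" using t by (auto simp: N_def)
    have "x \<notin> comp N t"
    proof
      assume "x \<in> comp N t"
      then have "reach N x t" using reach_sym by (simp add: comp_def)
      then have "t \<in> A'" by (rule reach_closed[OF _ True]) (use A'(5) in \<open>auto simp: N_def\<close>)
      then show False using t by blast
    qed
    moreover have "star_sep w (comp N t)"
      unfolding star_sep_def
    proof (intro conjI ballI allI impI)
      show "conn (comp N t)" by (rule comp_conn[OF tN])
      show "comp N t \<subseteq> V" "w \<notin> comp N t" using comp_subset[OF tN] by (auto simp: N_def)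
      show "\<not> E w a" if "a \<in> comp N t" for a using that comp_subset[OF tN] by (auto simp: N_def)
      show "b \<in> comp N t \<or> E w b" if "a \<in> comp N t" "E a b" for a b
      proof (cases "b \<in> N")
        case True
        then show ?thesis using comp_closed[OF that(1) tN that(2)] by blast
      next
        case False
        then have "b = w \<or> E w b" using inV[OF that(2)] by (auto simp: N_def)
        moreover have "b \<noteq> w" using that comp_subset[OF tN] Esym by (auto simp: N_def)
        ultimately show ?thesis by blast
      qed
      show "\<exists>t'\<in>V. t' \<notin> comp N t \<and> t' \<noteq> w \<and> \<not> E w t'" using xV xw \<open>x \<notin> comp N t\<close> by blast
    qed
    ultimately show False using small by blast
  qed
qed

text \<open>The arms that \<open>rigid_arm\<close> grows from \<open>p2\<close> and
  \<open>p3\<close> must reach the same neighbour \<open>w\<close> of \<open>x\<close>. Two arms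
  ending at \<open>w\<close> form a theta, and \<open>theta344\<close> gives a path from
  \<open>s1\<close> back to \<open>y0\<close>; this produces a path from \<open>y0\<close> to
  \<open>y5\<close> with five inner vertices in \<open>A\<close> instead of four.\<close>

lemma no_star_sep: "\<not> star_sep x0 A0"
proof
  assume "star_sep x0 A0"
  then obtain x A where star_sep: "star_sep x A" and least: "\<And>x' A'. star_sep x' A' \<Longrightarrow> card A \<le> card A'"
    using ex_has_least_nat[of "\<lambda>(x, A). star_sep x A" "(x0, A0)" "\<lambda>(x, A). card A"] by auto
  have gd: "star_free w" if "w \<in> A" for w using star_free_in_smallest[OF star_sep least that] .
  have A: "conn A" "A \<subseteq> V" "x \<notin> A" "\<And>a. a \<in> A \<Longrightarrow> \<not> E x a" "\<And>a b. a \<in> A \<Longrightarrow> E a b \<Longrightarrow> b \<in> A \<or> E x b"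
    using star_sep unfolding star_sep_def by blast+
  obtain y0 y5 where y: "E x y0" "E x y5" "y0 \<noteq> y5" "\<exists>a\<in>A. E y0 a" "\<exists>a\<in>A. E y5 a"
    and rigid: "\<And>L. ipath (y0 # L @ [y5]) \<Longrightarrow> set L \<subseteq> A \<Longrightarrow> length L = 4"
    by (rule rigid_pair[OF star_sep]) (rule that; assumption)
  have yA: "y0 \<notin> A" "y5 \<notin> A" using A(4) y by blast+
  have n05: "\<not> E y0 y5" using no3[of x y0 y5] y Esym by blast
  obtain a b where ab: "a \<in> A" "E y0 a" "b \<in> A" "E y5 b" using y by blast
  then have "reach A a b" using A(1) by (auto simp: conn_def)
  then obtain P where P: "ipath P" "P \<noteq> []" "set P \<subseteq> A" "E y0 (hd P)" "E y5 (last P)"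
    "\<And>r. r \<in> set P \<Longrightarrow> E y0 r \<Longrightarrow> r = hd P" "\<And>r. r \<in> set P \<Longrightarrow> E y5 r \<Longrightarrow> r = last P"
    using shortest_path[of A a b "{u. E y0 u}" "{u. E y5 u}"] ab by (auto simp only: mem_Collect_eq)
  have yP: "y0 \<notin> set P" "y5 \<notin> set P" using P(3) yA by auto
  have hP: "hd P \<in> set P" "y5 \<noteq> hd P" using P(2) yP by auto
  have "E r y5 \<longleftrightarrow> r = last P" if "r \<in> set P" for r using P(5) P(7)[OF that] Esym by blast
  then have "ipath (P @ [y5])" using P(1,2) yP by (subst ipath_append) auto
  moreover have "E y0 r \<longleftrightarrow> r = hd P" if "r \<in> set P" for r using P(4) P(6)[OF that] by blast
  ultimately have ipP: "ipath (y0 # P @ [y5])" using P(2) yP n05 hP y(3) by (subst ipath_Cons) auto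
  then have "length P = 4" using rigid P(3) by blast
  then obtain p1 p2 p3 p4 where Pp: "P = [p1,p2,p3,p4]" by (auto simp: length_Suc_conv eval_nat_numeral)
  have pA: "p1 \<in> A" "p2 \<in> A" "p3 \<in> A" "p4 \<in> A" using P(3) Pp by auto
  have xy: "x \<noteq> y0" "x \<noteq> y5" using y Eirr by auto
  have h: "hole7 x y0 p1 p2 p3 p4 y5"
    using ipP A(3) xy y Esym[OF y(2)] pA ipath_distinct[OF ipP] unfolding Pp hole7_def by auto
  have h': "hole7 x y5 p4 p3 p2 p1 y0" by (rule hole7_rots(6)[OF hole7_rev[OF h]])
  note ed = hole7_edges[OF h] and ch = hole7_chords[OF h]
  have dist: "distinct [x,y0,p1,p2,p3,p4,y5]" using h by (simp add: hole7_def)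
  have rigid': "length L = 4" if "ipath (y5 # L @ [y0])" "set L \<subseteq> A" for L
    using rigid[of "rev L"] ipath_rev[of "y5 # L @ [y0]"] that by simp
  have Ao: "\<forall>a\<in>A. \<not> E x a" "\<forall>a\<in>A. \<forall>b. E a b \<longrightarrow> b \<in> A \<or> E x b" using A(4,5) by blast+
  have ro: "\<forall>L. ipath (y0 # L @ [y5]) \<longrightarrow> set L \<subseteq> A \<longrightarrow> length L = 4"
    "\<forall>L. ipath (y5 # L @ [y0]) \<longrightarrow> set L \<subseteq> A \<longrightarrow> length L = 4"
    using rigid rigid' by blast+
  note ro' = ro(2) and ro = ro(1)
  have pA': "{p1,p2,p3,p4} \<subseteq> A" and pA'': "{p4,p3,p2,p1} \<subseteq> A" using pA by auto
  obtain n where n: "E p2 n" "n \<noteq> p1" "n \<noteq> p3" using degree3[of p2] pA A(2) by blast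
  obtain r1 r2 w where r: "E p2 r1" "E r1 r2" "E r2 w" "E w x" "r1 \<in> A" "r2 \<in> A"
    "r1 \<noteq> p1" "r1 \<noteq> p3" "w \<noteq> y0" "w \<noteq> y5" "r2 \<noteq> p2" "w \<noteq> r1"
    by (rule rigid_arm[OF Ao gd[OF pA(1)] gd[OF pA(3)] ro h pA' n]) (rule that; assumption)
  obtain n' where n': "E p3 n'" "n' \<noteq> p4" "n' \<noteq> p2" using degree3[of p3] pA A(2) by blast
  obtain s1 s2 w' where s: "E p3 s1" "E s1 s2" "E s2 w'" "E w' x" "s1 \<in> A" "s2 \<in> A"
    "s1 \<noteq> p4" "s1 \<noteq> p2" "w' \<noteq> y5" "w' \<noteq> y0" "s2 \<noteq> p3" "w' \<noteq> s1"
    by (rule rigid_arm[OF Ao gd[OF pA(4)] gd[OF pA(2)] ro' h' pA'' n']) (rule that; assumption)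
  have wA: "w \<notin> A" "w' \<notin> A" using A(4) r(4) s(4) Esym by blast+
  have ne: "p1 \<noteq> r2" "p4 \<noteq> s2" using r s ed no3[of p2 r1 r2] no3[of p3 s1 s2] by blast+
  have h1: "hole7 p2 r1 r2 w x y0 p1" and h2: "hole7 p3 s1 s2 w' x y5 p4"
    using r s ed dist ne wA yA pA A(3) neqE[OF r(1)] neqE[OF r(2)] neqE[OF s(1)] neqE[OF s(2)] neqE[OF r(4)] neqE[OF s(4)]
    unfolding hole7_def by auto
  define C1 where "C1 = {p2,r1,r2,w,x,y0,p1}"
  define C where "C = {x,y0,p1,p2,p3,p4,y5}"
  note ch1 = hole7_chords[OF h1] and ch2 = hole7_chords[OF h2]
  note ed1 = hole7_edges[OF h1] and ed2 = hole7_edges[OF h2]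
  have dist1: "distinct [p2,r1,r2,w,x,y0,p1]" using h1 by (simp add: hole7_def)
  have in1: "p2 \<in> C1" "w \<in> C1" "x \<in> C1" "{r1,r2} \<subseteq> C1" by (auto simp: C1_def)
  have p3C: "p3 \<notin> C1" using ed ch1 dist r(8) Eirr by (auto simp: C1_def)
  have p3E: "E p3 u \<longleftrightarrow> u = p2" if "u \<in> C1" for u
    using hole7_nbr[OF h1, of p3 p2 u] p3C ed that unfolding C1_def by auto
  have s1C: "s1 \<notin> C1" using p3E s by blast
  have s1E: "\<not> E s1 u" if "u \<in> C1" for u
    using hole7_nbrs[OF h1, of s1 p3 u p2] s1C p3C ed ed2 that unfolding C1_def by auto
  \<comment> \<open>Otherwise the two arms, the edge \<open>p2 p3\<close> and \<open>x\<close> form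
    a 9-hole.\<close>
  have "w = w'"
  proof (rule ccontr)
    assume ww: "w \<noteq> w'"
    have wC: "w' \<notin> C1" using ed1 ch1 s ww Eirr by (auto simp: C1_def)
    have wE: "E w' u \<longleftrightarrow> u = x" if "u \<in> C1" for u
      using hole7_nbr[OF h1, of w' x u] wC s(4) that unfolding C1_def by auto
    have s2C: "s2 \<notin> C1" using wE s A(3) ed2 by blast
    have s2E: "\<not> E s2 u" if "u \<in> C1" for u
      using hole7_nbrs[OF h1, of s2 w' u x] s2C wC s that unfolding C1_def by auto
    have "ipath [w,r2,r1,p2]" "ipath [p3,s1,s2,w']"
      using ch1 ch2 ed1 ed2 dist1 h2 unfolding hole7_def by auto
    then have "ipath ([w,r2,r1,p2] @ [p3,s1,s2,w'])"
    proof (rule ipath_appendI)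
      fix u v assume that: "u \<in> set [w,r2,r1,p2]" "v \<in> set [p3,s1,s2,w']"
      have "u \<in> C1" "u \<noteq> x" using that in1 dist1 by auto
      then have "E v u \<longleftrightarrow> u = p2 \<and> v = p3" "u \<noteq> v"
        using that p3E[of u] s1E[of u] s2E[of u] wE[of u] p3C s1C s2C wC s by auto
      then show "u \<noteq> v \<and> (E u v \<longleftrightarrow> u = last [w,r2,r1,p2] \<and> v = hd [p3,s1,s2,w'])"
        using Esym by auto
    qed simp_all
    then have ip: "ipath (w # [r2,r1,p2,p3,s1,s2] @ [w'])" by simp
    have "\<not> E w w'" using wE[of w] in1 dist1 Esym[of w w'] by auto
    then have "ipath (w # [x] @ [w'])" using ed1 ed2 ww dist1 h2 unfolding hole7_def by auto
    then have "length [r2,r1,p2,p3,s1,s2] + length [x] = 5"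
      using ch1 ch2 dist1 h2 by (intro glue[OF ip]) (auto simp: hole7_def)
    then show False by simp
  qed
  have s2C: "s2 \<notin> C1" using s1E s by blast
  have s2E: "E s2 u \<longleftrightarrow> u = w" if "u \<in> C1" for u
    using hole7_nbr[OF h1, of s2 w u] s2C s(3) \<open>w = w'\<close> that unfolding C1_def by auto
  have ip: "ipath [p3,s1,s2]" using ch2 ed2 h2 unfolding hole7_def by auto
  \<comment> \<open>On the hole \<open>C1\<close> the vertices \<open>p2\<close> and
    \<open>w\<close> are at distance three, and \<open>y0\<close> takes the position of
    \<open>f\<close> in \<open>theta344\<close>.\<close>
  then have j: "jump C1 [p3,s1,s2] p2 w"
    using p3C s1C s2C p3E s1E s2E ipath_distinct[OF ip] by (auto simp: jump_def)
  obtain n2 where n2: "E s1 n2" "n2 \<noteq> p3" "n2 \<noteq> s2" using degree3[of s1] s(5) A(2) by blast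
  obtain k1 k2 where k: "E s1 k1" "E k1 k2" "E k2 y0" "k1 \<noteq> p3" "k1 \<noteq> s2" "k1 \<notin> C1" "k2 \<notin> C1" "k2 \<noteq> s1"
    by (rule theta344[OF h1 C1_def j gd[OF pA(3)] gd[OF s(6)] n2]) (rule that; assumption)
  have inC: "y0 \<in> C" "p3 \<in> C" "p4 \<in> C" "y5 \<in> C" "x \<in> C" by (auto simp: C_def)
  have k2C: "k2 \<notin> C" using k(3,7) ch Eirr by (auto simp: C_def C1_def)
  have k2E: "E k2 u \<longleftrightarrow> u = y0" if "u \<in> C" for u
    using hole7_nbr[OF h, of k2 y0 u] k2C k(3) that unfolding C_def by auto
  have k1C: "k1 \<notin> C" using k2E[of k1] k(2,6) Esym[of k1 k2] by (auto simp: C1_def)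
  have k1E: "\<not> E k1 u" if "u \<in> C" for u
    using hole7_nbrs[OF h, of k1 k2 u y0] k1C k2C k(2,3) that unfolding C_def by auto
  have s1C': "s1 \<notin> C" using s(1,5,7,8) ch Eirr yA A(3) by (auto simp: C_def)
  have s1E': "E s1 u \<longleftrightarrow> u = p3" if "u \<in> C" for u
    using hole7_nbr[OF h, of s1 p3 u] s1C' ed2 that unfolding C_def by auto
  have "\<not> E k2 s1" using no3[of s1 k1 k2] k by blast
  then have "ipath [k2,k1,s1]" "ipath [p3,p4,y5]"
    using k(1,2,8) Esym neqE[OF k(1)] neqE[OF k(2)] ed ch dist by auto
  then have "ipath ([k2,k1,s1] @ [p3,p4,y5])"
  proof (rule ipath_appendI)
    fix u v assume "u \<in> set [k2,k1,s1]" "v \<in> set [p3,p4,y5]"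
    then show "u \<noteq> v \<and> (E u v \<longleftrightarrow> u = last [k2,k1,s1] \<and> v = hd [p3,p4,y5])"
      using inC k2C k1C s1C' k2E[of v] k1E[of v] s1E'[of v] neqE[OF k(1)] k(8) dist by auto
  qed simp_all
  moreover have "\<forall>u\<in>set [k2,k1,s1,p3,p4,y5]. u \<noteq> y0 \<and> (E u y0 \<longleftrightarrow> u = k2)"
    using inC k(3) k2C k1C s1C' k1E s1E'[of y0] ch dist by auto
  ultimately have "ipath (y0 # [k2,k1,s1,p3,p4] @ [y5])"
    using Esym[of y0] Esym[of _ y0] by (subst ipath_Cons) auto
  moreover have "\<not> E x k1" "\<not> E x k2" using k1E k2E[of x] inC dist Esym by auto
  then have "k1 \<in> A" "k2 \<in> A" using A(5)[OF s(5) k(1)] A(5)[OF _ k(2)] by blast+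
  ultimately have "length [k2,k1,s1,p3,p4] = 4" using s(5) pA by (intro rigid) auto
  then show False by simp
qed

lemma no_minimal_counterexample: False
proof -
  interpret hepta_star_free V E
    by unfold_locales (use degree3 no_star_sep in \<open>auto simp: star_free_def\<close>)
  show False using exists_hole7 no_hole7 by blast
qed

end

section \<open>Transfer to the graph library\<close>

fun steps :: "'a list \<Rightarrow> ('a \<times> 'a) list" where
  "steps (x # y # zs) = (x, y) # steps (y # zs)"
| "steps _ = []"

lemma length_steps: "length (steps xs) = length xs - 1"
  by (induction xs rule: steps.induct) auto

lemma steps_append: "xs \<noteq> [] \<Longrightarrow> steps (xs @ [a]) = steps xs @ [(last xs, a)]"
  by (induction xs rule: steps.induct) auto

lemma fst_steps: "fst ` set (steps (xs @ [a])) = set xs"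
  by (induction xs rule: steps.induct) auto

lemma set_steps: "successively R xs \<Longrightarrow> (u, v) \<in> set (steps xs) \<Longrightarrow> R u v"
  by (induction xs rule: steps.induct) auto

lemma pcas_steps: "pcas a (steps (a # xs)) (last (a # xs))"
  by (induction xs arbitrary: a) auto

lemma pawalk_verts_steps: "pawalk_verts a (steps (a # xs)) = a # xs"
  by (induction xs arbitrary: a) auto

lemma (in sgraph) ipath_edge_steps:
  "ipath q \<Longrightarrow> u \<in> set q \<Longrightarrow> v \<in> set q \<Longrightarrow> E u v \<Longrightarrow> (u, v) \<in> set (steps q) \<or> (v, u) \<in> set (steps q)"
proof (induction q rule: steps.induct)
  case (1 x y zs)
  then have p: "ipath (y # zs)" "\<And>z. z \<in> set (y # zs) \<Longrightarrow> E x z \<Longrightarrow> z = y" by auto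
  consider "u = x" "v = x" | "u = x" "v \<in> set (y # zs)" | "v = x" "u \<in> set (y # zs)"
    | "u \<in> set (y # zs)" "v \<in> set (y # zs)" using 1 by auto
  then show ?case
  proof cases
    case 1
    then show ?thesis using \<open>E u v\<close> Eirr by blast
  next
    case 2
    then show ?thesis using p(2)[of v] \<open>E u v\<close> by auto
  next
    case 3
    then show ?thesis using p(2)[of u] Esym[OF \<open>E u v\<close>] by auto
  next
    case 4
    then show ?thesis using 1 p(1) by auto
  qed
qed (auto simp: Eirr)

lemma graph_cycle_steps:
  assumes "successively (\<lambda>u v. (u, v) \<in> parcs G) (a # q)" "distinct (a # q)" "(last (a # q), a) \<in> parcs G"
    and "2 \<le> length q" "a \<in> pverts G"
  shows "graph_cycle G (steps (a # q @ [a]))"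
proof -
  let ?p = "steps (a # q @ [a])"
  have s: "set ?p \<subseteq> parcs G"
    using set_steps[OF assms(1)] assms(3) steps_append[of "a # q" a] by auto
  have "pcas a ?p a" using pcas_steps[of a "q @ [a]"] by simp
  then have "pre_digraph.awalk (with_proj G) a ?p a"
    using s assms(5) unfolding pre_digraph.awalk_def cas_with_proj_eq by simp
  moreover have "distinct (tl (pre_digraph.awalk_verts (with_proj G) a ?p))"
    using assms(2) pawalk_verts_steps[of a "q @ [a]"] unfolding awalk_verts_with_proj_eq by simp
  moreover have "?p \<noteq> []" "3 \<le> length ?p" using assms(4) length_steps[of "a # q @ [a]"] by auto
  ultimately show ?thesis unfolding graph_cycle_def pre_digraph.cycle_def by blast
qed

text \<open>Minimality is applied to vertex subsets, so the axioms are needed for the subgraph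
  induced by \<open>W\<close>. Its cycles and holes are cycles and holes of
  \<open>G\<close>.\<close>

lemma heptagraph_restrict:
  assumes G: "heptagraph G" and W: "W \<subseteq> pverts G"
  shows "hepta W (\<lambda>u v. (u, v) \<in> parcs G \<and> u \<in> W \<and> v \<in> W)" (is "hepta W ?E")
proof -
  interpret pair_graph G using G by (simp add: heptagraph_def)
  have no7: "\<not> graph_cycle G p" if "length p < 7" for p using G that by (auto simp: heptagraph_def)
  have no9: "\<not> hole G p" if "odd (length p)" "9 \<le> length p" for p using G that by (auto simp: heptagraph_def)
  have sym: "(v, u) \<in> parcs G" if "(u, v) \<in> parcs G" for u v
    using pair_sym_arcs that by (auto simp: symmetric_conv)
  interpret sgraph W ?E
    using W pair_finite_verts sym
    by unfold_locales (auto intro: finite_subset dest: pair_no_loops)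
  show ?thesis
  proof unfold_locales
    fix p assume p: "successively ?E p" "distinct p" "?E (last p) (hd p)" "3 \<le> length p"
    obtain a q where pq: "p = a # q" using p(4) by (cases p) auto
    have "successively (\<lambda>u v. (u, v) \<in> parcs G) (a # q)"
      using p(1) pq by (auto elim: successively_mono)
    then have "graph_cycle G (steps (a # q @ [a]))"
      using p pq W by (intro graph_cycle_steps) auto
    then show "7 \<le> length p" using no7[of "steps (a # q @ [a])"] pq length_steps[of "a # q @ [a]"]
      by (intro leI notI) auto
  next
    fix q a assume q: "ipath q" "a \<notin> set q" "\<forall>z\<in>set q. ?E a z \<longleftrightarrow> z = hd q \<or> z = last q"
      "even (length q)" "4 \<le> length q"
    let ?p = "steps (a # q @ [a])"
    have qne: "q \<noteq> []" using q by auto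
    have ah: "?E a (hd q)" "?E a (last q)" using q qne by auto
    have su: "successively ?E (a # q)" using ah ipath_successively[OF q(1)] qne by (simp add: successively_Cons)
    have cyc: "graph_cycle G ?p"
      using su q ah W qne sym ipath_distinct[OF q(1)]
      by (intro graph_cycle_steps) (auto elim: successively_mono)
    have len: "length ?p = length q + 1" by (simp add: length_steps)
    \<comment> \<open>Every vertex of \<open>q\<close> is the tail of an arc of the cycle, and the
      edges of \<open>?E\<close> lie inside \<open>W\<close>.\<close>
    have qW: "set q \<subseteq> W"
    proof
      fix u assume u: "u \<in> set q"
      have "u \<in> fst ` set ?p" using u fst_steps[of "a # q" a] by simp
      then obtain v where "(u, v) \<in> set ?p" by auto
      then have "(u, v) \<in> set (steps (a # q)) \<or> (u, v) = (last (a # q), a)"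
        using steps_append[of "a # q" a] qne by auto
      then show "u \<in> W" using set_steps[OF su] ah qne by auto
    qed
    have verts: "fst ` set ?p = set (a # q)" using fst_steps[of "a # q" a] by simp
    have setp: "set ?p = set (steps (a # q)) \<union> {(last q, a)}" using steps_append[of "a # q" a] qne by simp
    have "steps (a # q) = (a, hd q) # steps q" using qne by (cases q) auto
    with setp have setp': "set ?p = {(a, hd q), (last q, a)} \<union> set (steps q)" by auto
    have "arcs (with_proj G \<restriction> (fst ` set ?p)) = set ?p \<union> (set ?p)\<inverse>"
    proof (intro equalityI subsetI)
      fix e assume "e \<in> arcs (with_proj G \<restriction> (fst ` set ?p))"
      then obtain u v where e: "e = (u, v)" "(u, v) \<in> parcs G" "u \<in> set (a # q)" "v \<in> set (a # q)"
        unfolding verts by (cases e) (auto simp del: set_simps)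
      then have E: "?E u v" "?E v u" using qW ah sym by auto
      consider "u = a" "v = a" | "u = a" "v \<in> set q" | "v = a" "u \<in> set q" | "u \<in> set q" "v \<in> set q" using e by auto
      then show "e \<in> set ?p \<union> (set ?p)\<inverse>"
      proof cases
        case 1 then show ?thesis using E Eirr by blast
      next
        case 2 then show ?thesis using q(3) E(1) e setp' by auto
      next
        case 3 then show ?thesis using q(3) E(2) e setp' by auto
      next
        case 4 then show ?thesis using ipath_edge_steps[OF q(1)] E(1) e setp' by auto
      qed
    next
      fix e assume e: "e \<in> set ?p \<union> (set ?p)\<inverse>"
      have "(u, v) \<in> parcs G \<and> u \<in> set (a # q) \<and> v \<in> set (a # q)" if "(u, v) \<in> set ?p" for u v
      proof -
        have "u \<in> set (a # q)" using verts that by (metis fst_conv image_eqI)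
        moreover have "v \<in> set (a # q)"
        proof -
          have "snd ` set (steps xs) \<subseteq> set xs" for xs :: "'a list" by (induction xs rule: steps.induct) auto
          from this[of "a # q @ [a]"] that show ?thesis by force
        qed
        moreover have "(u, v) \<in> parcs G" using that setp set_steps[OF su, of u v] ah sym by auto
        ultimately show ?thesis by blast
      qed
      then show "e \<in> arcs (with_proj G \<restriction> (fst ` set ?p))" using e sym unfolding verts by (cases e) (auto simp del: set_simps)
    qed
    then have "hole G ?p" using cyc len q(5) by (auto simp: hole_def induced_cycle_def)
    \<comment> \<open>\<open>?p\<close> has \<open>length q + 1\<close> arcs, so only 7 remains
      among the odd lengths.\<close>
    then have "\<not> 9 \<le> length ?p" "\<not> length ?p < 7" using no9[of ?p] no7[of ?p] cyc len q(4) by auto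
    then have "length q = 6 \<or> length q = 7" using len by linarith
    then show "length q = 6" using q(4) by auto
  qed
qed

theorem theorem1p3:
  fixes G :: "'a pair_pre_digraph"
  assumes "heptagraph G"
  shows "\<exists>c :: 'a \<Rightarrow> nat. (\<forall>v \<in> pverts G. c v \<in> {1, 2, 3}) \<and>
           (\<forall>u v. (u, v) \<in> parcs G \<longrightarrow> c u \<noteq> c v)"
proof (rule ccontr)
  assume no: "\<not> ?thesis"
  interpret pair_graph G using assms by (simp add: heptagraph_def)
  \<comment> \<open>Cutting the edge relation down to \<open>W\<close> presents the induced subgraph
    in the form of the locales, so that a smallest set that is not colourable becomes an instance of
    \<open>crit\<close>.\<close>
  define edge where "edge W u v \<longleftrightarrow> (u, v) \<in> parcs G \<and> u \<in> W \<and> v \<in> W" for W u v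
  define colorable where "colorable W \<longleftrightarrow> (\<exists>c :: 'a \<Rightarrow> nat. (\<forall>u\<in>W. c u \<in> {1,2,3}) \<and>
    (\<forall>u\<in>W. \<forall>v\<in>W. (u, v) \<in> parcs G \<longrightarrow> c u \<noteq> c v))" for W
  have "\<not> colorable (pverts G)"
  proof
    assume "colorable (pverts G)"
    then obtain c :: "'a \<Rightarrow> nat" where "\<forall>v \<in> pverts G. c v \<in> {1, 2, 3}"
      "\<forall>u\<in>pverts G. \<forall>v\<in>pverts G. (u, v) \<in> parcs G \<longrightarrow> c u \<noteq> c v" unfolding colorable_def by blast
    then show False using no in_arcsD1 in_arcsD2 by blast
  qed
  then obtain W where W: "W \<subseteq> pverts G" "\<not> colorable W"
    and least: "\<And>U. U \<subseteq> pverts G \<and> \<not> colorable U \<Longrightarrow> card W \<le> card U"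
    using ex_has_least_nat[of "\<lambda>W. W \<subseteq> pverts G \<and> \<not> colorable W" "pverts G" card] by auto
  interpret hepta W "edge W" unfolding edge_def by (rule heptagraph_restrict[OF assms W(1)])
  have "crit W (edge W)"
  proof unfold_locales
    show "\<not> col W c" for c using W(2) unfolding colorable_def col_def edge_def by blast
    show "\<exists>c. col U c" if "U \<subset> W" for U
    proof -
      have "card U < card W" using that W(1) pair_finite_verts by (meson finite_subset psubset_card_mono)
      then have "colorable U" using least[of U] that W(1) by force
      then show ?thesis unfolding colorable_def col_def edge_def by blast
    qed
  qed
  then show False by (rule crit.no_minimal_counterexample)
qed

end
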